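(* Consider the multi-agent setting described in the context, with $\hat{\mathbf{M}}^i\preceq^{\delta^i}_0\mathbf{M}^i$ for all $i$, so that $\hat{\mathbf{M}}\preceq^{\boldsymbol\delta}_0\mathbf{M}$ with $\boldsymbol\delta=1-\prod_i(1-\delta^i)$. Let $\boldsymbol\pi=\{\pi[0],\ldots,\pi[T-1]\}\in\Pi_{\mathbf{M}}$, and let $\mathcal G^\delta_T$ be the tree obtained by $T$ steps of robust tensor-tree value iteration. Then one can construct a control strategy $\mathbf{C}_{\boldsymbol\pi}$ for $\mathbf{M}$ such that, for any $T\ge1$, $$\mathbb{P}_{\mathbf{M}\times\mathbf{C}_{\boldsymbol\pi}}\big(\boldsymbol l_{[0,T]}\models\phi\big)\;\ge\;\sum_{z\in\mathcal G^\delta_T:\ \mathcal L_Q(z)=\bar q_0}v^\delta_T(z)(\hat x_0),$$ where $\bar q_0=\tau_{\mathcal A}(q_0,L(\hat h(\hat x_0)))$ and $v^\delta_T(z)$ is the value of vertex $z$ in $\mathcal G^\delta_T$.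
   Context: Agents. For $i=1,\ldots,N$, agent $i$ is $x_i^+=f_i(x_i,u_i)+w_i$, $y_i=h_i(x_i)$, with $w_i$ i.i.d. with law $\mathbb{P}_{w_i}$, independent across agents. It is the gMDP $\mathbf{M}^i=(\mathbb{X}_i,\mathbb{U}_i,\mathbb{Y}_i,\mathbb{T}_i,x_{i,0},h_i)$ with $\mathbb{T}_i(dx'\mid x,u)=\mathbb{P}_{w_i}(dx'-f_i(x,u))$. A gMDP consists of Polish state and input spaces, a metric output space, a stochastic kernel, an initial state and a measurable output map. $\mathbf{M}$ is the Cartesian product of the $\mathbf{M}^i$: stacked states, inputs and outputs, $\mathbb{T}=\prod_i\mathbb{T}_i$, and output metric $\max_i d_{\mathbb{Y}_i}$. The finite gMDPs $\hat{\mathbf{M}}^i=(\hat{\mathbb{X}}_i,\hat{\mathbb{U}}_i,\hat{\mathbb{Y}}_i,\hat{\mathbb{T}}_i,\hat x_{i,0},\hat h_i)$ compose into $\hat{\mathbf{M}}$, with initial state $\hat x_0$. Simulation. $\hat{\mathbf{M}}^i\preceq^\delta_\epsilon\mathbf{M}^i$ means that there exist: - a measurable relation $\mathscr R^i\subset\hat{\mathbb{X}}_i\times\mathbb{X}_i$; - an interface $\mathcal U_i:\hat{\mathbb{U}}_i\times\hat{\mathbb{X}}_i\times\mathbb{X}_i\to\mathcal P(\mathbb{U}_i)$; - a kernel $\mathbb{W}_{\mathbb{T}^i}(\cdot\mid\hat u,\hat x,x)$; such that: - $(\hat x_{i,0},x_{i,0})\in\mathscr R^i$; - output distance is at most $\epsilon$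 on $\mathscr R^i$; - for every $\hat u$ and every $(\hat x,x)\in\mathscr R^i$, $\mathbb{W}_{\mathbb{T}^i}(\cdot\mid\hat u,\hat x,x)$ has marginals $\hat{\mathbb{T}}_i(\cdot\mid\hat x,\hat u)$ and $\mathbb{T}_i(\cdot\mid x,\mathcal U_i(\hat u,\hat x,x))$ and gives $\mathscr R^i$ mass at least $1-\delta$. The composed relation is $\{(\hat x,x):(\hat x_i,x_i)\in\mathscr R^i\ \forall i\}$. Specification. The sets $\mathrm{AP}_i$ are pairwise disjoint, with labelling maps $L^i:\mathbb{Y}_i\to2^{\mathrm{AP}_i}$ and $L(y)=\bigcup_iL^i(y_i)$. The DFA is $\mathcal A=(Q,q_0,2^{\mathrm{AP}},\tau_{\mathcal A},q_f)$, with transitions written $\tau_{\mathcal A}(q,\alpha)$ for conjunctions $\alpha$ of (possibly negated) atomic propositions, one per letter. $\alpha^i$ is the part of $\alpha$ over $\mathrm{AP}_i$, and $\mathcal L_{\alpha^i}(\hat x_i)=1$ iff $L^i(\hat h_i(\hat x_i))\models\alpha^i$, else $0$. Acceptance $\boldsymbol l_{[0,T]}\models\phi$ means that the DFA run on the labelled outputs $L(y[0]),L(y[1]),\ldots$ visits $q_f$ by time $T$. A control strategy maps finite histories to inputs. Policies and operators. $\Pi_{\mathbf{M}}$ is the set of Markov policies with $\pi[t]=\mathrm{col}(\pi^{(i)}[t])$ and $\pi^{(i)}[t]:\hat{\mathbb{X}}_i\times Q\to\hat{\mathbb{U}}_i$; write $\pi^{(i)}_q=\pi^{(i)}(\cdot,q)$.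 The robust per-agent operator is $$\mathbf{T}^{\pi^{(i)}_q}_{\delta^i,\alpha^i}(v^{(i)})(\hat x_i)=\mathbf L\Big(\mathbb{E}\big[\mathcal L_{\alpha^i}(\hat x_i')v^{(i)}(\hat x_i')\big]-\delta^i\Big),\qquad \hat x_i'\sim\hat{\mathbb{T}}_i(\cdot\mid\hat x_i,\pi^{(i)}_q(\hat x_i)),$$ where $\mathbf L(a)=\min\{1,\max\{0,a\}\}$. Robust tensor tree. The tree is rooted, with vertices $z$, labelled edges $(z,\alpha,z')$, DFA labels $\mathcal L_Q(z)\in Q$, and rank-one values $v(z)=\bigotimes_iv^{(i)}(z)$, so that $v(z)(\hat x)=\prod_iv^{(i)}(z)(\hat x_i)$. - Initial tree $\mathcal G^\delta_0$: a single root labelled $q_f$ with value $\bigotimes_i\mathbf 1$. - Grow: for each leaf $z$ and each DFA transition $(q,\alpha,q')$ with $q'=\mathcal L_Q(z)$, add a vertex $\bar z$ labelled $q$ and the edge $(z,\alpha,\bar z)$. - Robust iteration with policy $\pi$: Grow, then for every edge $(z,\alpha,z')$ set $v^{(i)}(z')=\mathbf{T}^{\pi^{(i)}_{\mathcal L_Q(z')}}_{\delta^i,\alpha^i}(v^{(i)}(z))$ for all $i$. - $\mathcal G^\delta_{t+1}$ is obtained from $\mathcal G^\delta_t$ by the robust iteration with policy $\pi[T-1-t]$.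
   Formalization: Grow uses only DFA transitions (q,α,q') with q≠q_f; otherwise transitions from q_f back to q_f double count and the sum can exceed 1. Labelling maps and interfaces are taken measurable, and the control strategy may be randomised, as the interface takes values in P(U_i). *)

theory Defs
  imports "HOL-Probability.Probability"
begin

definition glob_label :: "nat \<Rightarrow> (nat \<Rightarrow> 'y \<Rightarrow> 'ap set) \<Rightarrow> (nat \<Rightarrow> 'x \<Rightarrow> 'y) \<Rightarrow> (nat \<Rightarrow> 'x) \<Rightarrow> 'ap set" where
  "glob_label N L h x = (\<Union>i<N. L i (h i (x i)))"

fun dfa_run :: "('q \<Rightarrow> 'ap set \<Rightarrow> 'q) \<Rightarrow> 'q \<Rightarrow> (nat \<Rightarrow> 'ap set) \<Rightarrow> nat \<Rightarrow> 'q" where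
  "dfa_run tau q0 w 0 = tau q0 (w 0)"
| "dfa_run tau q0 w (Suc k) = tau (dfa_run tau q0 w k) (w (Suc k))"

definition accepts_by :: "('q \<Rightarrow> 'ap set \<Rightarrow> 'q) \<Rightarrow> 'q \<Rightarrow> 'q \<Rightarrow> (nat \<Rightarrow> 'ap set) \<Rightarrow> nat \<Rightarrow> bool" where
  "accepts_by tau q0 qf w T \<longleftrightarrow> (\<exists>k\<le>T. dfa_run tau q0 w k = qf)"

definition clamp01 :: "real \<Rightarrow> real" where
  "clamp01 a = min 1 (max 0 a)"

text \<open>A letter sg (subset of AP) is the conjunction alpha of literals; alpha^i is its part
  over AP_i. labs |= alpha^i iff labs agrees with sg on AP_i.\<close>
definition sat_part :: "'ap set \<Rightarrow> 'ap set \<Rightarrow> 'ap set \<Rightarrow> bool" where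
  "sat_part APi sg labs \<longleftrightarrow> (\<forall>p\<in>APi. p \<in> labs \<longleftrightarrow> p \<in> sg)"

definition ind_alpha :: "'ap set \<Rightarrow> ('y \<Rightarrow> 'ap set) \<Rightarrow> ('xh \<Rightarrow> 'y) \<Rightarrow> 'ap set \<Rightarrow> 'xh \<Rightarrow> real" where
  "ind_alpha APi Li hhi sg xh = (if sat_part APi sg (Li (hhi xh)) then 1 else 0)"

definition robust_op :: "('xh \<Rightarrow> 'uh \<Rightarrow> 'xh pmf) \<Rightarrow> ('xh \<Rightarrow> real) \<Rightarrow> real \<Rightarrow> ('xh \<Rightarrow> 'uh)
    \<Rightarrow> ('xh \<Rightarrow> real) \<Rightarrow> 'xh \<Rightarrow> real" where
  "robust_op Th Lalpha del polq v xh =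
     clamp01 (measure_pmf.expectation (Th xh (polq xh)) (\<lambda>xh'. Lalpha xh' * v xh') - del)"

text \<open>A vertex is identified with its path from the root: the root is [], and the child of z
  along edge (z, sg, z') with DFA label q is (sg, q) # z.\<close>
type_synonym ('ap, 'q) vertex = "('ap set \<times> 'q) list"

fun vlabel :: "'q \<Rightarrow> ('ap, 'q) vertex \<Rightarrow> 'q" where
  "vlabel qf [] = qf"
| "vlabel qf ((sg, q) # z) = q"

definition tree_leaves :: "('ap, 'q) vertex set \<Rightarrow> ('ap, 'q) vertex set" where
  "tree_leaves V = {z \<in> V. \<not> (\<exists>e. e # z \<in> V)}"

definition grow :: "'ap set \<Rightarrow> 'q set \<Rightarrow> ('q \<Rightarrow> 'ap set \<Rightarrow> 'q) \<Rightarrow> 'q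
    \<Rightarrow> ('ap, 'q) vertex set \<Rightarrow> ('ap, 'q) vertex set" where
  "grow AP Q tau qf V = V \<union> {(sg, q) # z | z sg q.
      z \<in> tree_leaves V \<and> sg \<subseteq> AP \<and> q \<in> Q \<and> q \<noteq> qf \<and> tau q sg = vlabel qf z}"

fun tree_vertices :: "'ap set \<Rightarrow> 'q set \<Rightarrow> ('q \<Rightarrow> 'ap set \<Rightarrow> 'q) \<Rightarrow> 'q \<Rightarrow> nat
    \<Rightarrow> ('ap, 'q) vertex set" where
  "tree_vertices AP Q tau qf 0 = {[]}"
| "tree_vertices AP Q tau qf (Suc t) = grow AP Q tau qf (tree_vertices AP Q tau qf t)"

text \<open>Per-agent vertex values v^{(i)}(z) of G^delta_t (horizon T).  The root keeps the value 1;
  in iteration t+1 every edge (z, sg, z') is updated simultaneously from the values of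
  G^delta_t using policy pi[T-1-t].  Arguments: abstract kernels Th, atomic propositions APi,
  labellings L, abstract outputs hh, deltas del, policy pol (time, agent, state, dfa state).\<close>
fun tree_val :: "(nat \<Rightarrow> 'xh \<Rightarrow> 'uh \<Rightarrow> 'xh pmf) \<Rightarrow> (nat \<Rightarrow> 'ap set) \<Rightarrow> (nat \<Rightarrow> 'y \<Rightarrow> 'ap set)
    \<Rightarrow> (nat \<Rightarrow> 'xh \<Rightarrow> 'y) \<Rightarrow> (nat \<Rightarrow> real) \<Rightarrow> (nat \<Rightarrow> nat \<Rightarrow> 'xh \<Rightarrow> 'q \<Rightarrow> 'uh) \<Rightarrow> nat
    \<Rightarrow> nat \<Rightarrow> ('ap, 'q) vertex \<Rightarrow> nat \<Rightarrow> 'xh \<Rightarrow> real" where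
  "tree_val Th APi L hh del pol T 0 z i = (\<lambda>_. 1)"
| "tree_val Th APi L hh del pol T (Suc t) [] i = (\<lambda>_. 1)"
| "tree_val Th APi L hh del pol T (Suc t) ((sg, q) # z) i =
     robust_op (Th i) (ind_alpha (APi i) (L i) (hh i) sg) (del i)
       (\<lambda>xh. pol (T - 1 - t) i xh q) (tree_val Th APi L hh del pol T t z i)"

definition glob_space :: "nat \<Rightarrow> (nat \<Rightarrow> 'a measure) \<Rightarrow> (nat \<Rightarrow> 'a) measure" where
  "glob_space N M = PiM {..<N} M"

definition glob_kernel :: "nat \<Rightarrow> (nat \<Rightarrow> 'x \<Rightarrow> 'u \<Rightarrow> 'x measure) \<Rightarrow> (nat \<Rightarrow> 'x) \<Rightarrow> (nat \<Rightarrow> 'u)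
    \<Rightarrow> (nat \<Rightarrow> 'x) measure" where
  "glob_kernel N Tk x u = PiM {..<N} (\<lambda>i. Tk i (x i) (u i))"

definition hist_space :: "(nat \<Rightarrow> 'x) measure \<Rightarrow> (nat \<Rightarrow> 'u) measure \<Rightarrow> nat
    \<Rightarrow> ((nat \<Rightarrow> nat \<Rightarrow> 'x) \<times> (nat \<Rightarrow> nat \<Rightarrow> 'u)) measure" where
  "hist_space GX GU t = PiM {..t} (\<lambda>_. GX) \<Otimes>\<^sub>M PiM {..<t} (\<lambda>_. GU)"

definition is_strategy :: "(nat \<Rightarrow> 'x) measure \<Rightarrow> (nat \<Rightarrow> 'u) measure
    \<Rightarrow> (nat \<Rightarrow> (nat \<Rightarrow> nat \<Rightarrow> 'x) \<times> (nat \<Rightarrow> nat \<Rightarrow> 'u) \<Rightarrow> (nat \<Rightarrow> 'u) measure) \<Rightarrow> bool" where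
  "is_strategy GX GU C \<longleftrightarrow> (\<forall>t. C t \<in> hist_space GX GU t \<rightarrow>\<^sub>M prob_algebra GU)"

fun closed_loop :: "(nat \<Rightarrow> 'x) measure \<Rightarrow> (nat \<Rightarrow> 'u) measure
    \<Rightarrow> ((nat \<Rightarrow> 'x) \<Rightarrow> (nat \<Rightarrow> 'u) \<Rightarrow> (nat \<Rightarrow> 'x) measure) \<Rightarrow> (nat \<Rightarrow> 'x)
    \<Rightarrow> (nat \<Rightarrow> (nat \<Rightarrow> nat \<Rightarrow> 'x) \<times> (nat \<Rightarrow> nat \<Rightarrow> 'u) \<Rightarrow> (nat \<Rightarrow> 'u) measure) \<Rightarrow> nat
    \<Rightarrow> ((nat \<Rightarrow> nat \<Rightarrow> 'x) \<times> (nat \<Rightarrow> nat \<Rightarrow> 'u)) measure" where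
  "closed_loop GX GU TG x0 C 0 =
     return (hist_space GX GU 0) (\<lambda>j\<in>{..0}. x0, \<lambda>_. undefined)"
| "closed_loop GX GU TG x0 C (Suc t) =
     closed_loop GX GU TG x0 C t \<bind> (\<lambda>hs. C t hs \<bind> (\<lambda>u. TG (fst hs t) u \<bind> (\<lambda>x'.
       return (hist_space GX GU (Suc t)) ((fst hs)(Suc t := x'), (snd hs)(t := u)))))"

end

theory Submission
  imports Defs
begin

text \<open>
  The usual coupling argument lets the controller carry a simulated abstract state, sampled by
  disintegrating the couplings \<open>W i\<close>. No disintegration is needed here: since the abstract
  state spaces are finite, the controller can instead reconstruct the abstract state, at each
  step, as the one related to the current concrete state that maximises the tree value
  with the remaining horizon. A maximum dominates the value of any randomly coupled successor, so
  the process that is \<open>1\<close> after acceptance and equals this maximal tree value before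
  is a submartingale of the closed loop. It starts above the tree value at the abstract initial
  state and ends below the indicator of acceptance.
\<close>

subsection \<open>Finite products of probability kernels\<close>

text \<open>Nothing forces the maximising abstract states at successive times to follow one abstract
  trajectory: each step inequality only needs some related state before the step and compares with
  the maximum after it. The bound with \<open>s\<close> steps left therefore depends on the history
  only through the DFA state and the current concrete state, and a plain function of these two
  serves as controller. The price is that the maximiser must be chosen measurably, and that a
  concrete state whose chosen candidate is unrelated counts with value 0. The couplings are used
  only inside a one-step estimate. The product of the \<open>W i\<close> is formed there, bounds the
  tree recursion from above, and is then projected to its concrete components. What remains is the
  law produced by the interface and the true dynamics, so the closed loop never has to contain
  abstract states. All integrands are nonnegative, so the submartingale argument runs in
  \<open>ennreal\<close> and raises no integrability question.\<close>

lemma PiM_prob_eqI: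
  assumes I: "finite I" and M: "\<And>i. i \<in> I \<Longrightarrow> prob_space (M i)" and sets_nu: "sets \<nu> = sets (PiM I M)"
    and eq: "\<And>A. (\<And>i. i \<in> I \<Longrightarrow> A i \<in> sets (M i)) \<Longrightarrow>
      emeasure \<nu> (Pi\<^sub>E I A) = (\<Prod>i\<in>I. emeasure (M i) (A i))"
  shows "\<nu> = PiM I M"
proof -
  \<comment> \<open>The locale \<open>product_prob_space\<close> asks for a probability measure at
    every index. A Dirac measure is put in outside \<open>I\<close>, which leaves
    \<open>PiM I\<close> unchanged; the next lemmas use the same device.\<close>
  define M' where "M' = (\<lambda>i. if i \<in> I then M i else return (count_space UNIV) undefined)"
  have [simp]: "PiM I M' = PiM I M"
    by (intro PiM_cong) (simp_all add: M'_def)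
  have "prob_space (M' i)" for i
    using M by (simp add: M'_def prob_space_return)
  then interpret product_prob_space M' by (rule product_prob_spaceI)
  have "\<nu> = PiM I M'"
  proof (rule PiM_eqI[OF I])
    show "sets \<nu> = sets (PiM I M')" by (simp add: sets_nu)
  qed (use eq in \<open>auto simp: M'_def\<close>)
  then show ?thesis by simp
qed

lemma nn_integral_PiM_prod:
  assumes I: "finite I" and M: "\<And>i. i \<in> I \<Longrightarrow> prob_space (M i)"
    and f: "\<And>i. i \<in> I \<Longrightarrow> f i \<in> borel_measurable (M i)"
  shows "(\<integral>\<^sup>+x. (\<Prod>i\<in>I. f i (x i)) \<partial>PiM I M) = (\<Prod>i\<in>I. integral\<^sup>N (M i) (f i))"
proof -
  define M' where "M' = (\<lambda>i. if i \<in> I then M i else return (count_space UNIV) undefined)"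
  have [simp]: "PiM I M' = PiM I M"
    by (intro PiM_cong) (simp_all add: M'_def)
  have "prob_space (M' i)" for i
    using M by (simp add: M'_def prob_space_return)
  then interpret product_prob_space M' by (rule product_prob_spaceI)
  have "(\<integral>\<^sup>+x. (\<Prod>i\<in>I. f i (x i)) \<partial>PiM I M') = (\<Prod>i\<in>I. integral\<^sup>N (M' i) (f i))"
    by (rule product_nn_integral_prod) (use I f in \<open>auto simp: M'_def\<close>)
  also have "\<dots> = (\<Prod>i\<in>I. integral\<^sup>N (M i) (f i))"
    by (intro prod.cong) (auto simp: M'_def)
  finally show ?thesis by simp
qed

lemma emeasure_PiM_prob:
  assumes I: "finite I" and M: "\<And>i. i \<in> I \<Longrightarrow> prob_space (M i)"
    and A: "\<And>i. i \<in> I \<Longrightarrow> A i \<in> sets (M i)"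
  shows "emeasure (PiM I M) (Pi\<^sub>E I A) = (\<Prod>i\<in>I. emeasure (M i) (A i))"
proof -
  define M' where "M' = (\<lambda>i. if i \<in> I then M i else return (count_space UNIV) undefined)"
  have [simp]: "PiM I M' = PiM I M"
    by (intro PiM_cong) (simp_all add: M'_def)
  have "prob_space (M' i)" for i
    using M by (simp add: M'_def prob_space_return)
  then interpret product_prob_space M' by (rule product_prob_spaceI)
  have "emeasure (PiM I M') (Pi\<^sub>E I A) = (\<Prod>i\<in>I. emeasure (M' i) (A i))"
    by (rule emeasure_PiM) (use I A in \<open>auto simp: M'_def\<close>)
  also have "\<dots> = (\<Prod>i\<in>I. emeasure (M i) (A i))"
    by (intro prod.cong) (auto simp: M'_def)
  finally show ?thesis by simp
qed

text \<open>Rectangles form an intersection-stable generator, and on a rectangle the product kernel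
  is a finite product of measurable functions.\<close>

lemma measurable_PiM_kernel:
  assumes I: "finite I" and K: "\<And>i. i \<in> I \<Longrightarrow> K i \<in> M \<rightarrow>\<^sub>M prob_algebra (N i)"
  shows "(\<lambda>w. PiM I (\<lambda>i. K i w)) \<in> M \<rightarrow>\<^sub>M prob_algebra (PiM I N)"
proof -
  have Ksp: "sets (K i w) = sets (N i)" "prob_space (K i w)" if "i \<in> I" "w \<in> space M" for i w
    using measurable_space[OF K[OF that(1)] that(2)] by (auto simp: space_prob_algebra)
  show ?thesis
  proof (rule measurable_prob_algebra_generated[OF sets_PiM Int_stable_prod_algebra
        prod_algebra_sets_into_space])
    fix w assume w: "w \<in> space M"
    show "prob_space (PiM I (\<lambda>i. K i w))"
      by (rule prob_space_PiM) (use Ksp w in auto)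
    show "sets (PiM I (\<lambda>i. K i w)) = sets (PiM I N)"
      by (rule sets_PiM_cong) (use Ksp w in auto)
  next
    fix A assume "A \<in> prod_algebra I N"
    then obtain E where A: "A = Pi\<^sub>E I E" and E: "\<And>i. i \<in> I \<Longrightarrow> E i \<in> sets (N i)"
      by (metis prod_algebraE_all Pi_iff)
    have "emeasure (PiM I (\<lambda>i. K i w)) A = (\<Prod>i\<in>I. emeasure (K i w) (E i))" if "w \<in> space M" for w
      unfolding A by (rule emeasure_PiM_prob) (use I Ksp E that in auto)
    moreover have "(\<lambda>w. \<Prod>i\<in>I. emeasure (K i w) (E i)) \<in> borel_measurable M"
      by (intro borel_measurable_prod_ennreal
          measurable_compose[OF measurable_prob_algebraD[OF K] measurable_emeasure_subprob_algebra] E)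
    ultimately show "(\<lambda>w. emeasure (PiM I (\<lambda>i. K i w)) A) \<in> borel_measurable M"
      by (subst measurable_cong)
  qed
qed

text \<open>Drawing all inputs independently and then all successors independently amounts to
  running the agents separately. Both sides agree on rectangles because the integral of a product of
  one-coordinate functions factorises.\<close>

lemma bind_PiM:
  assumes I: "finite I" and \<mu>: "\<And>i. i \<in> I \<Longrightarrow> \<mu> i \<in> space (prob_algebra (M i))"
    and K: "\<And>i. i \<in> I \<Longrightarrow> K i \<in> M i \<rightarrow>\<^sub>M prob_algebra (N i)"
  shows "PiM I \<mu> \<bind> (\<lambda>u. PiM I (\<lambda>i. K i (u i))) = PiM I (\<lambda>i. \<mu> i \<bind> K i)"
proof -
  have \<mu>': "sets (\<mu> i) = sets (M i)" "prob_space (\<mu> i)" if "i \<in> I" for i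
    using \<mu>[OF that] by (auto simp: space_prob_algebra)
  have PK: "(\<lambda>u. PiM I (\<lambda>i. K i (u i))) \<in> PiM I M \<rightarrow>\<^sub>M prob_algebra (PiM I N)"
  proof (rule measurable_PiM_kernel[OF I])
    show "(\<lambda>u. K i (u i)) \<in> PiM I M \<rightarrow>\<^sub>M prob_algebra (N i)" if "i \<in> I" for i
      using that by (intro measurable_compose[OF _ K[OF that]] measurable_component_singleton)
  qed
  have P\<mu>: "PiM I \<mu> \<in> space (prob_algebra (PiM I M))"
    using \<mu>' by (auto simp: space_prob_algebra intro!: prob_space_PiM sets_PiM_cong)
  have sb: "sets (\<mu> i \<bind> K i) = sets (N i)" "prob_space (\<mu> i \<bind> K i)" if "i \<in> I" for i
    using sets_bind'[OF \<mu>[OF that] K[OF that]] prob_space_bind'[OF \<mu>[OF that] K[OF that]] .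
  have Ku: "sets (K i v) = sets (N i)" "prob_space (K i v)" if "i \<in> I" "v \<in> space (M i)" for i v
    using measurable_space[OF K[OF that(1)] that(2)] by (auto simp: space_prob_algebra)
  show ?thesis
  proof (rule PiM_prob_eqI[OF I sb(2)])
    show "sets (PiM I \<mu> \<bind> (\<lambda>u. PiM I (\<lambda>i. K i (u i)))) = sets (PiM I (\<lambda>i. \<mu> i \<bind> K i))"
      unfolding sets_bind'[OF P\<mu> PK] by (rule sets_PiM_cong) (auto simp: sb(1))
    fix A assume "\<And>i. i \<in> I \<Longrightarrow> A i \<in> sets (\<mu> i \<bind> K i)"
    then have A: "\<And>i. i \<in> I \<Longrightarrow> A i \<in> sets (N i)" using sb by auto
    have "emeasure (PiM I \<mu> \<bind> (\<lambda>u. PiM I (\<lambda>i. K i (u i)))) (Pi\<^sub>E I A)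
      = (\<integral>\<^sup>+u. emeasure (PiM I (\<lambda>i. K i (u i))) (Pi\<^sub>E I A) \<partial>PiM I \<mu>)"
      by (rule emeasure_bind_prob_algebra[OF P\<mu> PK]) (use I A in \<open>auto intro: sets_PiM_I_finite\<close>)
    also have "\<dots> = (\<integral>\<^sup>+u. (\<Prod>i\<in>I. emeasure (K i (u i)) (A i)) \<partial>PiM I \<mu>)"
    proof (rule nn_integral_cong)
      fix u assume "u \<in> space (PiM I \<mu>)"
      then have "u i \<in> space (M i)" if "i \<in> I" for i
        using that \<mu>'(1)[OF that, THEN sets_eq_imp_space_eq] by (auto simp: space_PiM)
      then show "emeasure (PiM I (\<lambda>i. K i (u i))) (Pi\<^sub>E I A) = (\<Prod>i\<in>I. emeasure (K i (u i)) (A i))"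
        by (intro emeasure_PiM_prob) (use I Ku A in auto)
    qed
    also have "\<dots> = (\<Prod>i\<in>I. \<integral>\<^sup>+v. emeasure (K i v) (A i) \<partial>\<mu> i)"
    proof (rule nn_integral_PiM_prod[OF I \<mu>'(2)])
      fix i assume i: "i \<in> I"
      have "(\<lambda>v. emeasure (K i v) (A i)) \<in> borel_measurable (M i)"
        using i A by (intro measurable_compose[OF measurable_prob_algebraD[OF K]
            measurable_emeasure_subprob_algebra])
      then show "(\<lambda>v. emeasure (K i v) (A i)) \<in> borel_measurable (\<mu> i)"
        using \<mu>'(1)[OF i] by (simp cong: measurable_cong_sets)
    qed
    also have "\<dots> = (\<Prod>i\<in>I. emeasure (\<mu> i \<bind> K i) (A i))"
      by (intro prod.cong refl emeasure_bind_prob_algebra[symmetric]) (use \<mu> K A in auto)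
    finally show "emeasure (PiM I \<mu> \<bind> (\<lambda>u. PiM I (\<lambda>i. K i (u i)))) (Pi\<^sub>E I A)
      = (\<Prod>i\<in>I. emeasure (\<mu> i \<bind> K i) (A i))" .
  qed
qed

text \<open>Used with \<open>f i = snd\<close>, to read off the concrete marginal of a product of
  couplings.\<close>

lemma distr_PiM_prob:
  assumes I: "finite I" and \<mu>: "\<And>i. i \<in> I \<Longrightarrow> prob_space (\<mu> i)"
    and f: "\<And>i. i \<in> I \<Longrightarrow> f i \<in> \<mu> i \<rightarrow>\<^sub>M N i"
  shows "distr (PiM I \<mu>) (PiM I N) (\<lambda>w. \<lambda>i\<in>I. f i (w i)) = PiM I (\<lambda>i. distr (\<mu> i) (N i) (f i))"
proof (rule PiM_prob_eqI[OF I])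
  show "prob_space (distr (\<mu> i) (N i) (f i))" if "i \<in> I" for i
    by (rule prob_space.prob_space_distr[OF \<mu>[OF that] f[OF that]])
  show "sets (distr (PiM I \<mu>) (PiM I N) (\<lambda>w. \<lambda>i\<in>I. f i (w i))) = sets (PiM I (\<lambda>i. distr (\<mu> i) (N i) (f i)))"
    unfolding sets_distr by (rule sets_PiM_cong) auto
  fix A assume A: "\<And>i. i \<in> I \<Longrightarrow> A i \<in> sets (distr (\<mu> i) (N i) (f i))"
  have meas: "(\<lambda>w. \<lambda>i\<in>I. f i (w i)) \<in> PiM I \<mu> \<rightarrow>\<^sub>M PiM I N"
  proof (rule measurable_restrict)
    show "(\<lambda>w. f i (w i)) \<in> PiM I \<mu> \<rightarrow>\<^sub>M N i" if "i \<in> I" for i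
      using that by (intro measurable_compose[OF _ f[OF that]] measurable_component_singleton)
  qed
  have "(\<lambda>w. \<lambda>i\<in>I. f i (w i)) -` Pi\<^sub>E I A \<inter> space (PiM I \<mu>) = (\<Pi>\<^sub>E i\<in>I. f i -` A i \<inter> space (\<mu> i))"
    by (auto simp: space_PiM PiE_iff)
  moreover have "Pi\<^sub>E I A \<in> sets (PiM I N)"
    using I A by (auto intro: sets_PiM_I_finite)
  ultimately have "emeasure (distr (PiM I \<mu>) (PiM I N) (\<lambda>w. \<lambda>i\<in>I. f i (w i))) (Pi\<^sub>E I A)
    = emeasure (PiM I \<mu>) (\<Pi>\<^sub>E i\<in>I. f i -` A i \<inter> space (\<mu> i))"
    using meas by (simp add: emeasure_distr)
  also have "\<dots> = (\<Prod>i\<in>I. emeasure (\<mu> i) (f i -` A i \<inter> space (\<mu> i)))"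
    by (rule emeasure_PiM_prob[OF I \<mu>]) (use A f in \<open>auto intro: measurable_sets\<close>)
  also have "\<dots> = (\<Prod>i\<in>I. emeasure (distr (\<mu> i) (N i) (f i)) (A i))"
    by (intro prod.cong refl) (use A f in \<open>auto simp: emeasure_distr\<close>)
  finally show "emeasure (distr (PiM I \<mu>) (PiM I N) (\<lambda>w. \<lambda>i\<in>I. f i (w i))) (Pi\<^sub>E I A)
    = (\<Prod>i\<in>I. emeasure (distr (\<mu> i) (N i) (f i)) (A i))" .
qed

text \<open>Finiteness of \<open>S\<close> replaces a selection theorem: the winner so far is
  compared with one new index at a time, and each comparison is a measurable case
  distinction.\<close>

lemma measurable_argmax:
  fixes f :: "'a \<Rightarrow> 'b \<Rightarrow> real"
  assumes "finite S" "S \<noteq> {}" and "\<And>a. a \<in> S \<Longrightarrow> f a \<in> borel_measurable M"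
  shows "\<exists>g \<in> M \<rightarrow>\<^sub>M count_space S. \<forall>x\<in>space M. \<forall>a\<in>S. f a x \<le> f (g x) x"
  using assms
proof (induction S rule: finite_ne_induct)
  case (singleton a)
  then show ?case by (intro bexI[of _ "\<lambda>_. a"]) auto
next
  case (insert a S)
  have "\<exists>g \<in> M \<rightarrow>\<^sub>M count_space S. \<forall>x\<in>space M. \<forall>b\<in>S. f b x \<le> f (g x) x"
    by (rule insert.IH) (simp add: insert.prems)
  then obtain g where g: "g \<in> M \<rightarrow>\<^sub>M count_space S"
    and gmax: "\<And>x b. x \<in> space M \<Longrightarrow> b \<in> S \<Longrightarrow> f b x \<le> f (g x) x" by blast
  have g': "g \<in> M \<rightarrow>\<^sub>M count_space (insert a S)"
    by (rule measurable_compose[OF g]) auto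
  have [measurable]: "(\<lambda>x. f (g x) x) \<in> borel_measurable M"
    by (rule measurable_compose_countable'[OF _ g])
      (simp_all add: insert.prems insert.hyps countable_finite)
  have [measurable]: "f a \<in> borel_measurable M" by (simp add: insert.prems)
  have "(\<lambda>x. if f (g x) x \<le> f a x then a else g x) \<in> M \<rightarrow>\<^sub>M count_space (insert a S)"
    by (intro measurable_If g') auto
  moreover have "f b x \<le> f (if f (g x) x \<le> f a x then a else g x) x"
    if "x \<in> space M" "b \<in> insert a S" for b x
    using that(2) gmax[OF that(1), of b] by (cases "b = a") auto
  ultimately show ?case
    by (intro bexI[of _ "\<lambda>x. if f (g x) x \<le> f a x then a else g x"] ballI)
qed

subsection \<open>The tensor tree\<close>

text \<open>Growing only the leaves has the same effect as growing every vertex, since an inner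
  vertex got all its children earlier. Hence the tree after \<open>t\<close> steps consists of all
  backward DFA paths from \<open>qf\<close> with at most \<open>t\<close> edges that do not return
  to \<open>qf\<close>.\<close>

lemma tree_vertices_Suc:
  "tree_vertices AP Q tau qf (Suc t) = insert [] {(sg, q) # z | z sg q.
     z \<in> tree_vertices AP Q tau qf t \<and> sg \<subseteq> AP \<and> q \<in> Q \<and> q \<noteq> qf \<and> tau q sg = vlabel qf z}"
    (is "?V (Suc t) = insert [] (?ch (?V t))")
proof (induction t)
  case 0
  show ?case by (auto simp: grow_def tree_leaves_def)
next
  case (Suc t)
  have mono: "?V t \<subseteq> ?V (Suc t)" by (auto simp: grow_def)
  have root: "[] \<in> ?V (Suc t)" using Suc by simp
  have sub: "?V (Suc t) \<subseteq> insert [] (?ch (?V (Suc t)))"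
    using mono by (subst Suc) blast
  \<comment> \<open>A non-leaf has a child in the tree; by the induction hypothesis a child is
    present only if its parent belongs to the previous tree.\<close>
  have inner: "z \<in> ?V t" if "z \<in> ?V (Suc t)" "z \<notin> tree_leaves (?V (Suc t))" for z
    using that unfolding tree_leaves_def Suc by auto
  show ?case
  proof
    show "?V (Suc (Suc t)) \<subseteq> insert [] (?ch (?V (Suc t)))"
      using sub unfolding tree_vertices.simps(2)[of _ _ _ _ "Suc t"] grow_def
      by (auto simp: tree_leaves_def)
    show "insert [] (?ch (?V (Suc t))) \<subseteq> ?V (Suc (Suc t))"
    proof
      fix y assume "y \<in> insert [] (?ch (?V (Suc t)))"
      then consider "y = []" | "y \<in> ?ch (tree_leaves (?V (Suc t)))" | "y \<in> ?ch (?V t)"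
        using inner by blast
      then show "y \<in> ?V (Suc (Suc t))"
      proof cases
        case 1 then show ?thesis using root by (simp add: grow_def)
      next
        case 2 then show ?thesis
          unfolding tree_vertices.simps(2)[of _ _ _ _ "Suc t"] grow_def by blast
      next
        case 3 then have "y \<in> ?V (Suc t)" unfolding Suc by blast
        then show ?thesis unfolding tree_vertices.simps(2)[of _ _ _ _ "Suc t"] grow_def by blast
      qed
    qed
  qed
qed

lemma finite_tree_vertices:
  assumes "finite AP" "finite Q"
  shows "finite (tree_vertices AP Q tau qf t)"
proof (induction t)
  case (Suc t)
  have "tree_vertices AP Q tau qf (Suc t) \<subseteq>
    insert [] ((\<lambda>(e, z). e # z) ` ((Pow AP \<times> Q) \<times> tree_vertices AP Q tau qf t))"
    unfolding tree_vertices_Suc by auto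
  then show ?case
    by (rule finite_subset) (use Suc assms in auto)
qed auto

lemma robust_op_range: "0 \<le> robust_op Th Lalpha del polq v xh" "robust_op Th Lalpha del polq v xh \<le> 1"
  by (auto simp: robust_op_def clamp01_def)

lemma tree_val_range:
  "0 \<le> tree_val Th APi L hh del pol T t z i xh" "tree_val Th APi L hh del pol T t z i xh \<le> 1"
proof -
  have "0 \<le> tree_val Th APi L hh del pol T t z i xh \<and> tree_val Th APi L hh del pol T t z i xh \<le> 1"
  proof (cases t)
    case (Suc s)
    then show ?thesis by (cases z) (auto simp: robust_op_range)
  qed simp
  then show "0 \<le> tree_val Th APi L hh del pol T t z i xh"
    "tree_val Th APi L hh del pol T t z i xh \<le> 1" by auto
qed

lemma tree_val_Nil [simp]: "tree_val Th APi L hh del pol T t [] i = (\<lambda>_. 1)"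
  by (cases t) auto

text \<open>The coupling puts mass at most \<open>\<delta>\<close> outside \<open>R\<close> and
  \<open>g\<close> is at most 1, so discarding the part outside \<open>R\<close> costs no more than
  the subtracted \<open>\<delta>\<close>. The result is an integral restricted to the
  relation.\<close>

lemma robust_op_le_coupling:
  assumes fin: "finite S" and p: "set_pmf p \<subseteq> S"
    and W: "W \<in> space (prob_algebra (count_space S \<Otimes>\<^sub>M M))"
    and R: "R \<in> sets (count_space S \<Otimes>\<^sub>M M)"
    and marg: "\<And>a. a \<in> S \<Longrightarrow> measure W ({a} \<times> space M) = pmf p a"
    and WR: "1 - \<delta> \<le> measure W R"
    and g: "\<And>a. 0 \<le> g a" "\<And>a. g a \<le> 1"
  shows "ennreal (clamp01 (measure_pmf.expectation p g - \<delta>))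
    \<le> (\<integral>\<^sup>+w. ennreal (g (fst w)) * indicator R w \<partial>W)"
proof -
  have sW: "sets W = sets (count_space S \<Otimes>\<^sub>M M)" using W by (simp add: space_prob_algebra)
  have spW: "space W = S \<times> space M"
    using sets_eq_imp_space_eq[OF sW] by (simp add: space_pair_measure)
  interpret W: prob_space W using W by (simp add: space_prob_algebra)
  have RW: "R \<in> sets W" using R sW by simp
  have gm: "(\<lambda>w. g (fst w)) \<in> borel_measurable W"
  proof -
    have "fst \<in> W \<rightarrow>\<^sub>M count_space S" unfolding measurable_cong_sets[OF sW refl] by simp
    then show ?thesis by (rule measurable_compose) simp
  qed
  have gi: "integrable W (\<lambda>w. g (fst w))"
    by (rule W.integrable_const_bound[of _ 1]) (use g gm in auto)
  have gRi: "integrable W (\<lambda>w. g (fst w) * indicator R w)"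
    by (rule integrable_real_mult_indicator[OF RW gi])
  have cRi: "integrable W (\<lambda>w. indicator (space W - R) w :: real)"
    using RW by (intro integrable_real_indicator) (auto simp: W.emeasure_eq_measure)
  have rect: "{a} \<times> space M \<in> sets W" if "a \<in> S" for a
    unfolding sW using that by (intro pair_measureI) auto
  \<comment> \<open>Since \<open>S\<close> is finite, the expectation is a sum over points, and the
    marginal on singletons suffices to carry it over to \<open>W\<close>.\<close>
  have "measure_pmf.expectation p g = (\<Sum>a\<in>S. pmf p a * g a)"
    by (subst integral_measure_pmf[OF fin]) (use p in auto)
  also have "\<dots> = (\<Sum>a\<in>S. \<integral>w. g a * indicator ({a} \<times> space M) w \<partial>W)"
    using rect by (intro sum.cong) (auto simp: marg W.emeasure_eq_measure Int_absorb2 sets.sets_into_space)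
  also have "\<dots> = (\<integral>w. (\<Sum>a\<in>S. g a * indicator ({a} \<times> space M) w) \<partial>W)"
    using rect by (intro Bochner_Integration.integral_sum[symmetric])
      (auto intro!: integrable_mult_right integrable_real_indicator simp: W.emeasure_eq_measure)
  also have "\<dots> = (\<integral>w. g (fst w) \<partial>W)"
  proof (rule Bochner_Integration.integral_cong[OF refl])
    fix w assume "w \<in> space W"
    then have w: "fst w \<in> S" "snd w \<in> space M" by (auto simp: spW)
    have "(\<Sum>a\<in>S. g a * indicator ({a} \<times> space M) w) = (\<Sum>a\<in>S. if a = fst w then g a else 0)"
      using w by (intro sum.cong) (auto simp: indicator_def mem_Times_iff)
    then show "(\<Sum>a\<in>S. g a * indicator ({a} \<times> space M) w) = g (fst w)"
      using w fin by simp
  qed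
  \<comment> \<open>Pointwise, \<open>g\<close> is bounded by its restriction to \<open>R\<close>
    plus the indicator of the complement, because \<open>g\<close> is at most 1.\<close>
  also have "\<dots> \<le> (\<integral>w. g (fst w) * indicator R w + indicator (space W - R) w \<partial>W)"
    by (rule integral_mono[OF gi Bochner_Integration.integrable_add[OF gRi cRi]])
      (use g in \<open>auto simp: indicator_def\<close>)
  also have "\<dots> = (\<integral>w. g (fst w) * indicator R w \<partial>W) + measure W (space W - R)"
    unfolding Bochner_Integration.integral_add[OF gRi cRi] using RW by (simp add: Int_absorb2)
  also have "measure W (space W - R) = 1 - measure W R"
    by (rule W.prob_compl[OF RW])
  finally have "measure_pmf.expectation p g - \<delta> \<le> (\<integral>w. g (fst w) * indicator R w \<partial>W)"
    using WR by linarith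
  moreover have "0 \<le> (\<integral>w. g (fst w) * indicator R w \<partial>W)"
    using g by (intro integral_nonneg_AE) auto
  \<comment> \<open>The lower clamp is absorbed by nonnegativity of the integral; the upper clamp
    only decreases the left side.\<close>
  ultimately have "clamp01 (measure_pmf.expectation p g - \<delta>) \<le> (\<integral>w. g (fst w) * indicator R w \<partial>W)"
    by (simp add: clamp01_def)
  then have "ennreal (clamp01 (measure_pmf.expectation p g - \<delta>))
    \<le> ennreal (\<integral>w. g (fst w) * indicator R w \<partial>W)" by (rule ennreal_leI)
  also have "\<dots> = (\<integral>\<^sup>+w. ennreal (g (fst w) * indicator R w) \<partial>W)"
    by (rule nn_integral_eq_integral[symmetric, OF gRi]) (use g in auto)
  also have "\<dots> = (\<integral>\<^sup>+w. ennreal (g (fst w)) * indicator R w \<partial>W)"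
    by (intro nn_integral_cong) (auto simp: indicator_def)
  finally show ?thesis .
qed

subsection \<open>Closed-loop histories\<close>

lemma dfa_run_cong:
  assumes "\<And>k. k \<le> t \<Longrightarrow> w k = w' k"
  shows "dfa_run tau q w t = dfa_run tau q w' t"
  using assms by (induction t) auto

lemma accepts_by_0 [simp]: "accepts_by tau q qf w 0 \<longleftrightarrow> tau q (w 0) = qf"
  by (simp add: accepts_by_def)

lemma accepts_by_Suc:
  "accepts_by tau q qf w (Suc t) \<longleftrightarrow> accepts_by tau q qf w t \<or> dfa_run tau q w (Suc t) = qf"
  by (auto simp: accepts_by_def le_Suc_eq)

lemma accepts_by_cong:
  assumes "\<And>k. k \<le> t \<Longrightarrow> w k = w' k"
  shows "accepts_by tau q qf w t \<longleftrightarrow> accepts_by tau q qf w' t"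
  using assms dfa_run_cong[of _ w w' tau q] unfolding accepts_by_def
  by (metis order_trans)

lemma measurable_hist_state:
  assumes "k \<le> t"
  shows "(\<lambda>hs. fst hs k) \<in> hist_space GX GU t \<rightarrow>\<^sub>M GX"
proof -
  have "fst \<in> hist_space GX GU t \<rightarrow>\<^sub>M PiM {..t} (\<lambda>_. GX)" by (simp add: hist_space_def)
  then show ?thesis
    by (rule measurable_compose) (use assms in simp)
qed

locale controlled_kernel =
  fixes GX :: "(nat \<Rightarrow> 'x) measure" and GU :: "(nat \<Rightarrow> 'u) measure"
    and TG :: "(nat \<Rightarrow> 'x) \<Rightarrow> (nat \<Rightarrow> 'u) \<Rightarrow> (nat \<Rightarrow> 'x) measure"
    and x0 :: "nat \<Rightarrow> 'x"
    and C :: "nat \<Rightarrow> (nat \<Rightarrow> nat \<Rightarrow> 'x) \<times> (nat \<Rightarrow> nat \<Rightarrow> 'u) \<Rightarrow> (nat \<Rightarrow> 'u) measure"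
  assumes TG: "(\<lambda>(x, u). TG x u) \<in> GX \<Otimes>\<^sub>M GU \<rightarrow>\<^sub>M prob_algebra GX"
    and x0_space: "x0 \<in> space GX"
    and C: "is_strategy GX GU C"
begin

abbreviation H :: "nat \<Rightarrow> ((nat \<Rightarrow> nat \<Rightarrow> 'x) \<times> (nat \<Rightarrow> nat \<Rightarrow> 'u)) measure" where
  "H t \<equiv> hist_space GX GU t"

text \<open>One transition of the closed loop as a kernel on histories, which turns
  \<open>closed_loop\<close> into iterated \<open>bind\<close> from a Dirac measure.\<close>

definition loop_step where
  "loop_step t hs = C t hs \<bind> (\<lambda>u. TG (fst hs t) u \<bind> (\<lambda>x'.
     return (H (Suc t)) ((fst hs)(Suc t := x'), (snd hs)(t := u))))"

lemma measurable_extend_hist: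
  "(\<lambda>((hs, u), x'). ((fst hs)(Suc t := x'), (snd hs)(t := u))) \<in> (H t \<Otimes>\<^sub>M GU) \<Otimes>\<^sub>M GX \<rightarrow>\<^sub>M H (Suc t)"
proof -
  have "(\<lambda>p. (fst (fst (fst p)))(Suc t := snd p)) \<in> (H t \<Otimes>\<^sub>M GU) \<Otimes>\<^sub>M GX \<rightarrow>\<^sub>M PiM {..Suc t} (\<lambda>_. GX)"
    by (rule measurable_fun_upd[where J="{..t}"]) (auto simp: hist_space_def)
  moreover have "(\<lambda>p. (snd (fst (fst p)))(t := snd (fst p))) \<in> (H t \<Otimes>\<^sub>M GU) \<Otimes>\<^sub>M GX \<rightarrow>\<^sub>M PiM {..<Suc t} (\<lambda>_. GU)"
    by (rule measurable_fun_upd[where J="{..<t}"]) (auto simp: hist_space_def)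
  ultimately show ?thesis
    unfolding hist_space_def[of GX GU "Suc t"] split_beta by (rule measurable_Pair)
qed

lemma measurable_TG_hist:
  "(\<lambda>p. TG (fst (fst p) t) (snd p)) \<in> H t \<Otimes>\<^sub>M GU \<rightarrow>\<^sub>M prob_algebra GX"
proof -
  have "(\<lambda>p. (fst (fst p) t, snd p)) \<in> H t \<Otimes>\<^sub>M GU \<rightarrow>\<^sub>M GX \<Otimes>\<^sub>M GU"
    by (intro measurable_Pair measurable_snd measurable_compose[OF measurable_fst measurable_hist_state]) simp
  from measurable_compose[OF this TG] show ?thesis by simp
qed

lemma measurable_extend_kernel:
  "(\<lambda>(hs, u). TG (fst hs t) u \<bind> (\<lambda>x'.
     return (H (Suc t)) ((fst hs)(Suc t := x'), (snd hs)(t := u)))) \<in> H t \<Otimes>\<^sub>M GU \<rightarrow>\<^sub>M prob_algebra (H (Suc t))"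
  unfolding split_beta
proof (rule measurable_bind_prob_space2[OF measurable_TG_hist])
  show "(\<lambda>(p, x'). return (H (Suc t)) ((fst (fst p))(Suc t := x'), (snd (fst p))(t := snd p)))
    \<in> (H t \<Otimes>\<^sub>M GU) \<Otimes>\<^sub>M GX \<rightarrow>\<^sub>M prob_algebra (H (Suc t))"
    using measurable_compose[OF measurable_extend_hist measurable_return_prob_space]
    by (simp add: split_beta)
qed

lemma measurable_loop_step: "loop_step t \<in> H t \<rightarrow>\<^sub>M prob_algebra (H (Suc t))"
proof -
  have "C t \<in> H t \<rightarrow>\<^sub>M prob_algebra GU" using C by (simp add: is_strategy_def)
  from measurable_bind_prob_space2[OF this measurable_extend_kernel]
  show ?thesis unfolding loop_step_def[abs_def] by simp
qed

lemma closed_loop_Suc':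
  "closed_loop GX GU TG x0 C (Suc t) = closed_loop GX GU TG x0 C t \<bind> loop_step t"
  by (simp add: loop_step_def[abs_def])

lemma init_hist: "(\<lambda>j\<in>{..0}. x0, \<lambda>_. undefined) \<in> space (H 0)"
  using x0_space by (auto simp: hist_space_def space_pair_measure space_PiM)

lemma closed_loop_prob: "closed_loop GX GU TG x0 C t \<in> space (prob_algebra (H t))"
proof (induction t)
  case 0
  show ?case using init_hist by (auto simp: space_prob_algebra prob_space_return)
next
  case (Suc t)
  show ?case
    unfolding closed_loop_Suc'
    using sets_bind'[OF Suc measurable_loop_step] prob_space_bind'[OF Suc measurable_loop_step]
    by (simp add: space_prob_algebra)
qed

lemma nn_integral_loop_step:
  assumes F: "F \<in> borel_measurable (H (Suc t))" and hs: "hs \<in> space (H t)"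
  shows "(\<integral>\<^sup>+y. F y \<partial>loop_step t hs) =
    (\<integral>\<^sup>+u. \<integral>\<^sup>+x'. F ((fst hs)(Suc t := x'), (snd hs)(t := u)) \<partial>TG (fst hs t) u \<partial>C t hs)"
proof -
  have "C t hs \<in> space (prob_algebra GU)"
    using C hs by (auto simp: is_strategy_def dest: measurable_space)
  then have sC: "sets (C t hs) = sets GU" by (simp add: space_prob_algebra)
  have k1: "(\<lambda>u. TG (fst hs t) u \<bind> (\<lambda>x'. return (H (Suc t)) ((fst hs)(Suc t := x'), (snd hs)(t := u))))
    \<in> C t hs \<rightarrow>\<^sub>M subprob_algebra (H (Suc t))"
    unfolding measurable_cong_sets[OF sC refl]
    using measurable_compose[OF measurable_Pair1'[OF hs] measurable_extend_kernel]
    by (auto intro: measurable_prob_algebraD)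
  show ?thesis
    unfolding loop_step_def nn_integral_bind[OF F k1]
  proof (rule nn_integral_cong)
    fix u assume "u \<in> space (C t hs)"
    then have u: "u \<in> space GU" using sets_eq_imp_space_eq[OF sC] by simp
    then have hu: "(hs, u) \<in> space (H t \<Otimes>\<^sub>M GU)" using hs by (simp add: space_pair_measure)
    have sT: "sets (TG (fst hs t) u) = sets GX"
      using measurable_space[OF measurable_TG_hist hu] by (simp add: space_prob_algebra)
    have ext: "(\<lambda>x'. ((fst hs)(Suc t := x'), (snd hs)(t := u))) \<in> TG (fst hs t) u \<rightarrow>\<^sub>M H (Suc t)"
      unfolding measurable_cong_sets[OF sT refl]
      using measurable_compose[OF measurable_Pair1'[OF hu] measurable_extend_hist] by simp
    have k2: "(\<lambda>x'. return (H (Suc t)) ((fst hs)(Suc t := x'), (snd hs)(t := u)))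
      \<in> TG (fst hs t) u \<rightarrow>\<^sub>M subprob_algebra (H (Suc t))"
      by (rule measurable_compose[OF ext return_measurable])
    show "(\<integral>\<^sup>+y. F y \<partial>(TG (fst hs t) u \<bind>
        (\<lambda>x'. return (H (Suc t)) ((fst hs)(Suc t := x'), (snd hs)(t := u)))))
      = (\<integral>\<^sup>+x'. F ((fst hs)(Suc t := x'), (snd hs)(t := u)) \<partial>TG (fst hs t) u)"
      unfolding nn_integral_bind[OF F k2]
      by (intro nn_integral_cong nn_integral_return measurable_space[OF ext] F)
  qed
qed

text \<open>The expectation of \<open>F t\<close> cannot decrease along \<open>loop_step\<close>,
  and at time 0 it is the value of \<open>F 0\<close> at the deterministic initial history.\<close>

lemma closed_loop_submartingale:
  assumes F: "\<And>t. t \<le> T \<Longrightarrow> F t \<in> borel_measurable (H t)"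
    and step: "\<And>t hs. t < T \<Longrightarrow> hs \<in> space (H t) \<Longrightarrow> F t hs \<le>
      (\<integral>\<^sup>+u. \<integral>\<^sup>+x'. F (Suc t) ((fst hs)(Suc t := x'), (snd hs)(t := u)) \<partial>TG (fst hs t) u \<partial>C t hs)"
  shows "F 0 (\<lambda>j\<in>{..0}. x0, \<lambda>_. undefined) \<le> (\<integral>\<^sup>+hs. F T hs \<partial>closed_loop GX GU TG x0 C T)"
proof -
  have "t \<le> T \<Longrightarrow> F 0 (\<lambda>j\<in>{..0}. x0, \<lambda>_. undefined) \<le> (\<integral>\<^sup>+hs. F t hs \<partial>closed_loop GX GU TG x0 C t)" for t
  proof (induction t)
    case 0
    show ?case
      unfolding closed_loop.simps by (subst nn_integral_return[OF init_hist F]) simp_all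
  next
    case (Suc t)
    have sets: "sets (closed_loop GX GU TG x0 C t) = sets (H t)"
      using closed_loop_prob[of t] by (simp add: space_prob_algebra)
    have ls: "loop_step t \<in> closed_loop GX GU TG x0 C t \<rightarrow>\<^sub>M subprob_algebra (H (Suc t))"
      unfolding measurable_cong_sets[OF sets refl] by (rule measurable_prob_algebraD[OF measurable_loop_step])
    have "F 0 (\<lambda>j\<in>{..0}. x0, \<lambda>_. undefined) \<le> (\<integral>\<^sup>+hs. F t hs \<partial>closed_loop GX GU TG x0 C t)"
      by (rule Suc.IH) (use Suc.prems in simp)
    also have "\<dots> \<le> (\<integral>\<^sup>+hs. (\<integral>\<^sup>+y. F (Suc t) y \<partial>loop_step t hs) \<partial>closed_loop GX GU TG x0 C t)"
    proof (rule nn_integral_mono)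
      fix hs assume "hs \<in> space (closed_loop GX GU TG x0 C t)"
      then have hs: "hs \<in> space (H t)" using sets_eq_imp_space_eq[OF sets] by simp
      show "F t hs \<le> (\<integral>\<^sup>+y. F (Suc t) y \<partial>loop_step t hs)"
        unfolding nn_integral_loop_step[OF F[OF Suc.prems] hs] using Suc.prems hs by (intro step) auto
    qed
    also have "\<dots> = (\<integral>\<^sup>+y. F (Suc t) y \<partial>closed_loop GX GU TG x0 C (Suc t))"
      unfolding closed_loop_Suc' by (rule nn_integral_bind[symmetric, OF F[OF Suc.prems] ls])
    finally show ?case .
  qed
  then show ?thesis by simp
qed

end

subsection \<open>Refining the abstract policy\<close>

text \<open>The hypotheses in the form used below: output tolerance 0 has become equality of related
  outputs, and each labelling is composed with its output map.\<close>

locale simulated_agents =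
  fixes N :: nat
    and Xh :: "nat \<Rightarrow> 'xh set" and Uh :: "nat \<Rightarrow> 'uh set"
    and Th :: "nat \<Rightarrow> 'xh \<Rightarrow> 'uh \<Rightarrow> 'xh pmf"
    and hh :: "nat \<Rightarrow> 'xh \<Rightarrow> 'y"
    and Mx :: "nat \<Rightarrow> 'x measure" and Mu :: "nat \<Rightarrow> 'u measure"
    and Tk :: "nat \<Rightarrow> 'x \<Rightarrow> 'u \<Rightarrow> 'x measure"
    and h :: "nat \<Rightarrow> 'x \<Rightarrow> 'y"
    and APi :: "nat \<Rightarrow> 'ap set" and L :: "nat \<Rightarrow> 'y \<Rightarrow> 'ap set"
    and Q :: "'q set" and q0 :: 'q and tau :: "'q \<Rightarrow> 'ap set \<Rightarrow> 'q" and qf :: 'q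
    and del :: "nat \<Rightarrow> real"
    and R :: "nat \<Rightarrow> ('xh \<times> 'x) set"
    and Ui :: "nat \<Rightarrow> 'uh \<Rightarrow> 'xh \<Rightarrow> 'x \<Rightarrow> 'u measure"
    and W :: "nat \<Rightarrow> 'uh \<Rightarrow> 'xh \<Rightarrow> 'x \<Rightarrow> ('xh \<times> 'x) measure"
    and T :: nat
    and pol :: "nat \<Rightarrow> nat \<Rightarrow> 'xh \<Rightarrow> 'q \<Rightarrow> 'uh"
    and AP :: "'ap set"
  defines "AP \<equiv> (\<Union>i<N. APi i)"
  assumes Tk_kernel: "\<And>i. i < N \<Longrightarrow> (\<lambda>(x, u). Tk i x u) \<in> (Mx i \<Otimes>\<^sub>M Mu i) \<rightarrow>\<^sub>M prob_algebra (Mx i)"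
    and Xh_fin: "\<And>i. i < N \<Longrightarrow> finite (Xh i)" and Xh_ne: "\<And>i. i < N \<Longrightarrow> Xh i \<noteq> {}"
    and Th_in: "\<And>i xh uh. i < N \<Longrightarrow> xh \<in> Xh i \<Longrightarrow> uh \<in> Uh i \<Longrightarrow> set_pmf (Th i xh uh) \<subseteq> Xh i"
    and APi_fin: "\<And>i. i < N \<Longrightarrow> finite (APi i)"
    and APi_disj: "\<And>i j. i < N \<Longrightarrow> j < N \<Longrightarrow> i \<noteq> j \<Longrightarrow> APi i \<inter> APi j = {}"
    and L_range: "\<And>i y. i < N \<Longrightarrow> L i y \<subseteq> APi i"
    and label_meas: "\<And>i. i < N \<Longrightarrow> (\<lambda>x. L i (h i x)) \<in> Mx i \<rightarrow>\<^sub>M count_space UNIV"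
    and Q_fin: "finite Q" and q0_in: "q0 \<in> Q"
    and tau_in: "\<And>q sg. q \<in> Q \<Longrightarrow> sg \<subseteq> AP \<Longrightarrow> tau q sg \<in> Q"
    and R_meas: "\<And>i. i < N \<Longrightarrow> R i \<in> sets (count_space (Xh i) \<Otimes>\<^sub>M Mx i)"
    and R_out: "\<And>i xh x. i < N \<Longrightarrow> (xh, x) \<in> R i \<Longrightarrow> hh i xh = h i x"
    and Ui_kernel: "\<And>i uh xh. i < N \<Longrightarrow> uh \<in> Uh i \<Longrightarrow> xh \<in> Xh i \<Longrightarrow>
      Ui i uh xh \<in> Mx i \<rightarrow>\<^sub>M prob_algebra (Mu i)"
    and W_kernel: "\<And>i uh xh. i < N \<Longrightarrow> uh \<in> Uh i \<Longrightarrow> xh \<in> Xh i \<Longrightarrow>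
      W i uh xh \<in> Mx i \<rightarrow>\<^sub>M prob_algebra (count_space (Xh i) \<Otimes>\<^sub>M Mx i)"
    and W_marg1: "\<And>i uh xh x A. i < N \<Longrightarrow> uh \<in> Uh i \<Longrightarrow> (xh, x) \<in> R i \<Longrightarrow> A \<subseteq> Xh i \<Longrightarrow>
      measure (W i uh xh x) (A \<times> space (Mx i)) = measure_pmf.prob (Th i xh uh) A"
    and W_marg2: "\<And>i uh xh x B. i < N \<Longrightarrow> uh \<in> Uh i \<Longrightarrow> (xh, x) \<in> R i \<Longrightarrow> B \<in> sets (Mx i) \<Longrightarrow>
      measure (W i uh xh x) (Xh i \<times> B) = measure (Ui i uh xh x \<bind> Tk i x) B"
    and W_R: "\<And>i uh xh x. i < N \<Longrightarrow> uh \<in> Uh i \<Longrightarrow> (xh, x) \<in> R i \<Longrightarrow> 1 - del i \<le> measure (W i uh xh x) (R i)"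
    and pol_in: "\<And>t i xh q. t < T \<Longrightarrow> i < N \<Longrightarrow> xh \<in> Xh i \<Longrightarrow> q \<in> Q \<Longrightarrow> pol t i xh q \<in> Uh i"
    and T_pos: "1 \<le> T"
begin

abbreviation GX where "GX \<equiv> glob_space N Mx"
abbreviation GU where "GU \<equiv> glob_space N Mu"
abbreviation lab where "lab \<equiv> glob_label N L h"
abbreviation V where "V \<equiv> tree_vertices AP Q tau qf"
abbreviation tval where "tval \<equiv> tree_val Th APi L hh del pol T"
abbreviation Abs :: "(nat \<Rightarrow> 'xh) set" where "Abs \<equiv> PiE {..<N} Xh"

text \<open>\<open>s\<close> counts the remaining steps, and \<open>q\<close> has already read the
  label of \<open>a\<close>. With \<open>s = T\<close> this is the right-hand side of the bound to
  be shown.\<close>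

definition gval :: "nat \<Rightarrow> 'q \<Rightarrow> (nat \<Rightarrow> 'xh) \<Rightarrow> real" where
  "gval s q a = (\<Sum>z\<in>{z \<in> V s. vlabel qf z = q}. \<Prod>i<N. tval s z i (a i))"

definition related :: "(nat \<Rightarrow> 'xh) \<Rightarrow> (nat \<Rightarrow> 'x) \<Rightarrow> bool" where
  "related a x \<longleftrightarrow> (\<forall>i<N. (a i, x i) \<in> R i)"

text \<open>With the value 0 off the relation, the maximum can range over the fixed finite set
  \<open>Abs\<close> instead of a set that depends on \<open>x\<close>.\<close>

definition rval :: "nat \<Rightarrow> 'q \<Rightarrow> (nat \<Rightarrow> 'xh) \<Rightarrow> (nat \<Rightarrow> 'x) \<Rightarrow> real" where
  "rval s q a x = (if related a x then gval s q a else 0)"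

definition refine :: "nat \<Rightarrow> 'q \<Rightarrow> (nat \<Rightarrow> 'x) \<Rightarrow> nat \<Rightarrow> 'xh" where
  "refine s q = (SOME f. f \<in> GX \<rightarrow>\<^sub>M count_space Abs \<and>
     (\<forall>x\<in>space GX. \<forall>a\<in>Abs. rval s q a x \<le> rval s q (f x) x))"

definition best :: "nat \<Rightarrow> 'q \<Rightarrow> (nat \<Rightarrow> 'x) \<Rightarrow> real" where
  "best s q x = rval s q (refine s q x) x"

definition ctrl :: "nat \<Rightarrow> 'q \<Rightarrow> (nat \<Rightarrow> 'x) \<Rightarrow> (nat \<Rightarrow> 'u) measure" where
  "ctrl t q x = PiM {..<N} (\<lambda>i. let b = refine (T - t) q x i in Ui i (pol t i b q) b (x i))"

definition dstate :: "nat \<Rightarrow> (nat \<Rightarrow> nat \<Rightarrow> 'x) \<times> (nat \<Rightarrow> nat \<Rightarrow> 'u) \<Rightarrow> 'q" where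
  "dstate t hs = dfa_run tau q0 (\<lambda>k. lab (fst hs k)) t"

text \<open>A strategy must be a kernel at every time, while \<open>pol\<close> is constrained only
  before \<open>T\<close>; from time \<open>T\<close> on, the last control law is repeated.\<close>

definition strategy :: "nat \<Rightarrow> (nat \<Rightarrow> nat \<Rightarrow> 'x) \<times> (nat \<Rightarrow> nat \<Rightarrow> 'u) \<Rightarrow> (nat \<Rightarrow> 'u) measure" where
  "strategy t hs = ctrl (min t (T - 1)) (dstate t hs) (fst hs t)"

section \<open>Labels, DFA states and measurability of the controller\<close>

lemma AP_fin: "finite AP"
  using APi_fin by (auto simp: AP_def)

lemma space_GX_iff: "x \<in> space GX \<longleftrightarrow> x \<in> extensional {..<N} \<and> (\<forall>i<N. x i \<in> space (Mx i))"
  by (auto simp: glob_space_def space_PiM PiE_iff)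

lemma finite_Abs: "finite Abs"
  using Xh_fin by (intro finite_PiE) auto

lemma Abs_ne: "Abs \<noteq> {}"
  using Xh_ne by (auto simp: PiE_eq_empty_iff)

lemma glob_label_subset: "glob_label N L g x \<subseteq> AP"
  using L_range by (fastforce simp: glob_label_def AP_def)

text \<open>By disjointness, an atom of \<open>APi i\<close> can enter the union only through agent
  \<open>i\<close>. So reading a given letter splits into one condition per agent, which is why a
  product of per-agent indicators tests the whole letter.\<close>

lemma glob_label_eq_iff:
  assumes "sg \<subseteq> AP"
  shows "glob_label N L g x = sg \<longleftrightarrow> (\<forall>i<N. sat_part (APi i) sg (L i (g i (x i))))"
proof -
  have own: "p \<in> L i (g i (x i))" if "i < N" "j < N" "p \<in> APi i" "p \<in> L j (g j (x j))" for p i j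
    using that L_range[of j] APi_disj[of i j] by (cases "i = j") auto
  show ?thesis
  proof
    assume "glob_label N L g x = sg"
    then show "\<forall>i<N. sat_part (APi i) sg (L i (g i (x i)))"
      using own by (auto simp: glob_label_def sat_part_def)
  next
    assume *: "\<forall>i<N. sat_part (APi i) sg (L i (g i (x i)))"
    show "glob_label N L g x = sg"
    proof
      show "glob_label N L g x \<subseteq> sg"
        using * L_range by (fastforce simp: glob_label_def sat_part_def)
      show "sg \<subseteq> glob_label N L g x"
        using * assms by (fastforce simp: glob_label_def sat_part_def AP_def)
    qed
  qed
qed

lemma measurable_lab: "lab \<in> GX \<rightarrow>\<^sub>M count_space (Pow AP)"
proof (subst measurable_count_space_eq2)
  show "finite (Pow AP)" using AP_fin by simp
  have "lab -` {sg} \<inter> space GX \<in> sets GX" if sg: "sg \<in> Pow AP" for sg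
  proof -
    have "{x \<in> space GX. sat_part (APi i) sg (L i (h i (x i)))} \<in> sets GX" if i: "i < N" for i
    proof -
      have "(\<lambda>x. x i) \<in> GX \<rightarrow>\<^sub>M Mx i"
        unfolding glob_space_def using i by (intro measurable_component_singleton) simp
      from measurable_compose[OF this label_meas[OF i]]
      have "(\<lambda>x. L i (h i (x i))) -` {l. sat_part (APi i) sg l} \<inter> space GX \<in> sets GX"
        by (rule measurable_sets) simp
      moreover have "(\<lambda>x. L i (h i (x i))) -` {l. sat_part (APi i) sg l} \<inter> space GX
        = {x \<in> space GX. sat_part (APi i) sg (L i (h i (x i)))}" by auto
      ultimately show ?thesis by simp
    qed
    then have "{x \<in> space GX. \<forall>i\<in>{..<N}. sat_part (APi i) sg (L i (h i (x i)))} \<in> sets GX"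
      by (intro sets.sets_Collect_finite_All) auto
    moreover have "lab -` {sg} \<inter> space GX = {x \<in> space GX. \<forall>i\<in>{..<N}. sat_part (APi i) sg (L i (h i (x i)))}"
      using glob_label_eq_iff[of sg h] sg by auto
    ultimately show ?thesis by simp
  qed
  then show "lab \<in> space GX \<rightarrow> Pow AP \<and> (\<forall>a\<in>Pow AP. lab -` {a} \<inter> space GX \<in> sets GX)"
    using glob_label_subset by auto
qed

lemma dstate_in: "dstate t hs \<in> Q"
  unfolding dstate_def by (induction t) (simp_all add: tau_in q0_in glob_label_subset)

lemma measurable_dstate:
  assumes "k \<le> t"
  shows "dstate k \<in> hist_space GX GU t \<rightarrow>\<^sub>M count_space Q"
  using assms
proof (induction k)
  case 0
  have "(\<lambda>l. tau q0 l) \<in> count_space (Pow AP) \<rightarrow>\<^sub>M count_space Q"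
    using tau_in q0_in by auto
  from measurable_compose[OF measurable_compose[OF measurable_hist_state[OF 0] measurable_lab] this]
  show ?case by (simp add: dstate_def[abs_def])
next
  case (Suc k)
  have "(\<lambda>hs. tau (dstate k hs) (lab (fst hs (Suc k)))) \<in> hist_space GX GU t \<rightarrow>\<^sub>M count_space Q"
  proof (rule measurable_compose_countable'[where f="\<lambda>l hs. tau (dstate k hs) l" and I="Pow AP"])
    show "(\<lambda>hs. lab (fst hs (Suc k))) \<in> hist_space GX GU t \<rightarrow>\<^sub>M count_space (Pow AP)"
      using Suc.prems by (intro measurable_compose[OF measurable_hist_state measurable_lab])
    show "countable (Pow AP)" using AP_fin by (simp add: countable_finite)
    fix l assume "l \<in> Pow AP"
    then have "(\<lambda>q. tau q l) \<in> count_space Q \<rightarrow>\<^sub>M count_space Q" using tau_in by auto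
    from measurable_compose[OF Suc.IH this] Suc.prems
    show "(\<lambda>hs. tau (dstate k hs) l) \<in> hist_space GX GU t \<rightarrow>\<^sub>M count_space Q" by simp
  qed
  then show ?case by (simp add: dstate_def[abs_def])
qed

lemma measurable_rval:
  assumes a: "a \<in> Abs"
  shows "rval s q a \<in> borel_measurable GX"
proof -
  have "{x \<in> space GX. (a i, x i) \<in> R i} \<in> sets GX" if i: "i < N" for i
  proof -
    have "(\<lambda>x. x i) \<in> GX \<rightarrow>\<^sub>M Mx i"
      unfolding glob_space_def using i by (intro measurable_component_singleton) simp
    from measurable_sets[OF this sets_Pair1[OF R_meas[OF i], of "a i"]]
    show ?thesis by (simp add: vimage_def Int_def conj_commute)
  qed
  then have "{x \<in> space GX. \<forall>i\<in>{..<N}. (a i, x i) \<in> R i} \<in> sets GX"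
    by (intro sets.sets_Collect_finite_All) auto
  then have "{x \<in> space GX. related a x} \<in> sets GX"
    unfolding related_def Ball_def lessThan_iff .
  then show ?thesis
    unfolding rval_def[abs_def] by (intro measurable_If) simp_all
qed

lemma refine:
  shows measurable_refine: "refine s q \<in> GX \<rightarrow>\<^sub>M count_space Abs"
    and rval_le_best: "x \<in> space GX \<Longrightarrow> a \<in> Abs \<Longrightarrow> rval s q a x \<le> best s q x"
proof -
  have "\<exists>f. f \<in> GX \<rightarrow>\<^sub>M count_space Abs \<and> (\<forall>x\<in>space GX. \<forall>a\<in>Abs. rval s q a x \<le> rval s q (f x) x)"
    using measurable_argmax[where f="rval s q", OF finite_Abs Abs_ne measurable_rval] by blast
  from someI_ex[OF this] show "refine s q \<in> GX \<rightarrow>\<^sub>M count_space Abs"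
    "x \<in> space GX \<Longrightarrow> a \<in> Abs \<Longrightarrow> rval s q a x \<le> best s q x"
    unfolding refine_def[symmetric] best_def by auto
qed

lemma refine_in: "x \<in> space GX \<Longrightarrow> refine s q x \<in> Abs"
  using measurable_space[OF measurable_refine] by simp

lemma measurable_best: "best s q \<in> borel_measurable GX"
  unfolding best_def[abs_def]
  by (rule measurable_compose_countable'[OF measurable_rval measurable_refine])
    (simp_all add: finite_Abs countable_finite)

lemma measurable_ctrl:
  assumes t: "t < T" and q: "q \<in> Q"
  shows "ctrl t q \<in> GX \<rightarrow>\<^sub>M prob_algebra GU"
proof -
  let ?f = "\<lambda>a x. PiM {..<N} (\<lambda>i. Ui i (pol t i (a i) q) (a i) (x i))"
  \<comment> \<open>The abstract state is frozen first; the finitely many resulting kernels are then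
    glued along the measurable selection \<open>refine\<close>.\<close>
  have "?f a \<in> GX \<rightarrow>\<^sub>M prob_algebra GU" if a: "a \<in> Abs" for a
    unfolding glob_space_def
  proof (rule measurable_PiM_kernel)
    fix i assume "i \<in> {..<N}"
    then have i: "i < N" and ai: "a i \<in> Xh i" using a by auto
    have "(\<lambda>x. x i) \<in> PiM {..<N} Mx \<rightarrow>\<^sub>M Mx i"
      using i by (intro measurable_component_singleton) simp
    from measurable_compose[OF this Ui_kernel[OF i pol_in[OF t i ai q] ai]]
    show "(\<lambda>x. Ui i (pol t i (a i) q) (a i) (x i)) \<in> PiM {..<N} Mx \<rightarrow>\<^sub>M prob_algebra (Mu i)" .
  qed simp
  then have "(\<lambda>x. ?f (refine (T - t) q x) x) \<in> GX \<rightarrow>\<^sub>M prob_algebra GU"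
    by (rule measurable_compose_countable'[OF _ measurable_refine])
      (simp_all add: finite_Abs countable_finite)
  then show ?thesis by (simp add: ctrl_def[abs_def] Let_def)
qed

lemma is_strategy_strategy: "is_strategy GX GU strategy"
  unfolding is_strategy_def strategy_def[abs_def]
proof
  fix t
  show "(\<lambda>hs. ctrl (min t (T - 1)) (dstate t hs) (fst hs t)) \<in> hist_space GX GU t \<rightarrow>\<^sub>M prob_algebra GU"
  proof (rule measurable_compose_countable'[OF _ measurable_dstate[OF order_refl]])
    fix q assume "q \<in> Q"
    then have "ctrl (min t (T - 1)) q \<in> GX \<rightarrow>\<^sub>M prob_algebra GU"
      using T_pos by (intro measurable_ctrl) auto
    then show "(\<lambda>hs. ctrl (min t (T - 1)) q (fst hs t)) \<in> hist_space GX GU t \<rightarrow>\<^sub>M prob_algebra GU"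
      by (rule measurable_compose[OF measurable_hist_state[OF order_refl]])
  qed (simp add: Q_fin countable_finite)
qed

lemma measurable_glob_kernel:
  "(\<lambda>(x, u). glob_kernel N Tk x u) \<in> GX \<Otimes>\<^sub>M GU \<rightarrow>\<^sub>M prob_algebra GX"
  unfolding glob_kernel_def glob_space_def split_beta
proof (rule measurable_PiM_kernel)
  fix i assume "i \<in> {..<N}"
  then have i: "i < N" by simp
  have "(\<lambda>p. (fst p i, snd p i)) \<in> PiM {..<N} Mx \<Otimes>\<^sub>M PiM {..<N} Mu \<rightarrow>\<^sub>M Mx i \<Otimes>\<^sub>M Mu i"
    using i by (intro measurable_Pair measurable_compose[OF measurable_fst measurable_component_singleton]
        measurable_compose[OF measurable_snd measurable_component_singleton]) auto
  from measurable_compose[OF this Tk_kernel[OF i]]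
  show "(\<lambda>p. Tk i (fst p i) (snd p i)) \<in> PiM {..<N} Mx \<Otimes>\<^sub>M PiM {..<N} Mu \<rightarrow>\<^sub>M prob_algebra (Mx i)"
    by simp
qed simp

section \<open>Tree values as a recursion in the remaining horizon\<close>

lemma gval_cong: "(\<And>i. i < N \<Longrightarrow> a i = b i) \<Longrightarrow> gval s q a = gval s q b"
  unfolding gval_def by (intro sum.cong prod.cong) auto

text \<open>\<open>grow\<close> adds no vertex labelled \<open>qf\<close>, so the root is the only
  one, and its value is 1 at every horizon.\<close>

lemma gval_qf: "gval s qf a = 1"
proof -
  have "{z \<in> V s. vlabel qf z = qf} = {[]}"
    by (cases s) (auto simp only: tree_vertices_Suc tree_vertices.simps(1) vlabel.simps)
  then show ?thesis by (simp add: gval_def)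
qed

lemma gval_0: "q \<noteq> qf \<Longrightarrow> gval 0 q a = 0"
  by (auto simp: gval_def intro!: sum.neutral)

lemma best_qf_le: "best s qf x \<le> 1"
  by (simp add: best_def rval_def gval_qf)

lemma best_0: "q \<noteq> qf \<Longrightarrow> best 0 q x = 0"
  by (simp add: best_def rval_def gval_0)

text \<open>Below the root, a vertex labelled \<open>q\<close> is determined by its letter and its
  parent, so the sum over vertices becomes a sum over edges into the smaller tree.\<close>

lemma gval_Suc:
  assumes q: "q \<in> Q" "q \<noteq> qf"
  shows "gval (Suc s) q a =
    (\<Sum>(sg, z)\<in>{(sg, z). sg \<subseteq> AP \<and> z \<in> V s \<and> tau q sg = vlabel qf z}.
      \<Prod>i<N. robust_op (Th i) (ind_alpha (APi i) (L i) (hh i) sg) (del i)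
        (\<lambda>xh. pol (T - 1 - s) i xh q) (tval s z i) (a i))"
proof -
  let ?E = "{(sg, z). sg \<subseteq> AP \<and> z \<in> V s \<and> tau q sg = vlabel qf z}"
  have "{z \<in> V (Suc s). vlabel qf z = q} = (\<lambda>(sg, z). (sg, q) # z) ` ?E"
    unfolding tree_vertices_Suc using q by (force simp: image_iff)
  then have "gval (Suc s) q a = (\<Sum>z\<in>(\<lambda>(sg, z). (sg, q) # z) ` ?E. \<Prod>i<N. tval (Suc s) z i (a i))"
    by (simp only: gval_def)
  also have "\<dots> = (\<Sum>e\<in>?E. \<Prod>i<N. tval (Suc s) ((\<lambda>(sg, z). (sg, q) # z) e) i (a i))"
    by (subst sum.reindex) (auto simp: inj_on_def)
  finally show ?thesis by (simp add: split_beta)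
qed

lemma related_in_Abs:
  assumes "related a x" "a \<in> extensional {..<N}"
  shows "a \<in> Abs"
proof -
  have "a i \<in> Xh i" if "i < N" for i
    using assms(1) that sets.sets_into_space[OF R_meas[OF that]]
    by (auto simp: related_def space_pair_measure)
  with assms(2) show ?thesis by (auto simp: PiE_iff)
qed

text \<open>This is where output tolerance 0 enters: related states emit the same letter, so the DFA
  driven by concrete outputs follows the edges weighted by abstract ones.\<close>

lemma related_label:
  assumes "related a x"
  shows "glob_label N L hh a = lab x"
proof -
  have "hh i (a i) = h i (x i)" if "i < N" for i
    using assms R_out[OF that] that by (auto simp: related_def)
  then show ?thesis by (simp add: glob_label_def)
qed

text \<open>If one agent leaves its relation, every term vanishes. Otherwise the first components
  form a state related to \<open>x'\<close>, only edges carrying the letter \<open>lab x'\<close>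
  survive, and their sum is a tree value at that state. Here the randomly coupled successor is
  replaced by the maximiser.\<close>

lemma sum_edges_le_best:
  assumes w: "\<And>i. i < N \<Longrightarrow> w i \<in> Xh i \<times> space (Mx i)"
  defines "x' \<equiv> \<lambda>i\<in>{..<N}. snd (w i)"
  shows "(\<Sum>(sg, z)\<in>{(sg, z). sg \<subseteq> AP \<and> z \<in> V s \<and> tau q sg = vlabel qf z}.
      \<Prod>i<N. ennreal (ind_alpha (APi i) (L i) (hh i) sg (fst (w i)) * tval s z i (fst (w i)))
        * indicator (R i) (w i)) \<le> ennreal (best s (tau q (lab x')) x')"
    (is "(\<Sum>(sg, z)\<in>?E. ?term sg z) \<le> _")
proof (cases "\<forall>i<N. w i \<in> R i")
  case False
  then obtain i where "i < N" "w i \<notin> R i" by auto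
  then have zero: "?term sg z = 0" for sg z
    by (intro prod_zero) (auto intro!: bexI[of _ i])
  show ?thesis unfolding split_beta zero by simp
next
  case True
  define a where "a = (\<lambda>i\<in>{..<N}. fst (w i))"
  have rel: "related a x'"
    using True by (auto simp: related_def a_def x'_def)
  have aAbs: "a \<in> Abs" by (rule related_in_Abs[OF rel]) (simp add: a_def)
  have x': "x' \<in> space GX"
    using w by (auto simp: space_GX_iff x'_def mem_Times_iff)
  define l where "l = lab x'"
  have l: "l \<subseteq> AP" unfolding l_def by (rule glob_label_subset)
  have labh: "glob_label N L hh a = l" unfolding l_def by (rule related_label[OF rel])
  have finV: "finite (V s)" by (rule finite_tree_vertices[OF AP_fin Q_fin])
  have finE: "finite ?E"
    by (rule finite_subset[of _ "Pow AP \<times> V s"]) (use AP_fin finV in auto)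
  \<comment> \<open>The product of the agents' indicators is the indicator of
    \<open>sg = l\<close>.\<close>
  have term_eq: "?term sg z = ennreal (if sg = l then \<Prod>i<N. tval s z i (a i) else 0)"
    if sg: "sg \<subseteq> AP" for sg z
  proof -
    have "?term sg z = (\<Prod>i<N. ennreal (ind_alpha (APi i) (L i) (hh i) sg (a i) * tval s z i (a i)))"
      using True by (intro prod.cong) (auto simp: a_def)
    also have "\<dots> = ennreal (\<Prod>i<N. ind_alpha (APi i) (L i) (hh i) sg (a i) * tval s z i (a i))"
      by (intro prod_ennreal mult_nonneg_nonneg) (auto simp: ind_alpha_def tree_val_range)
    also have "(\<Prod>i<N. ind_alpha (APi i) (L i) (hh i) sg (a i) * tval s z i (a i))
      = (if sg = l then \<Prod>i<N. tval s z i (a i) else 0)"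
    proof (cases "sg = l")
      case True
      then have "\<forall>i<N. sat_part (APi i) sg (L i (hh i (a i)))"
        using glob_label_eq_iff[OF sg, of hh a] labh by simp
      with True show ?thesis by (simp add: ind_alpha_def)
    next
      case False
      then obtain i where "i < N" "\<not> sat_part (APi i) sg (L i (hh i (a i)))"
        using glob_label_eq_iff[OF sg, of hh a] labh by auto
      then have "(\<Prod>i<N. ind_alpha (APi i) (L i) (hh i) sg (a i) * tval s z i (a i)) = 0"
        by (intro prod_zero) (auto simp: ind_alpha_def intro!: bexI[of _ i])
      with False show ?thesis by simp
    qed
    finally show ?thesis .
  qed
  have "(\<Sum>(sg, z)\<in>?E. ?term sg z)
      = (\<Sum>(sg, z)\<in>?E. ennreal (if sg = l then \<Prod>i<N. tval s z i (a i) else 0))"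
    by (intro sum.cong refl) (clarsimp simp: term_eq)
  also have "\<dots> = (\<Sum>(sg, z)\<in>(\<lambda>z. (l, z)) ` {z \<in> V s. vlabel qf z = tau q l}.
      ennreal (if sg = l then \<Prod>i<N. tval s z i (a i) else 0))"
    by (rule sum.mono_neutral_right[OF finE]) (use l in auto)
  also have "\<dots> = (\<Sum>z\<in>{z \<in> V s. vlabel qf z = tau q l}. ennreal (\<Prod>i<N. tval s z i (a i)))"
    by (subst sum.reindex) (auto simp: inj_on_def)
  also have "\<dots> = ennreal (gval s (tau q l) a)"
    unfolding gval_def by (intro sum_ennreal prod_nonneg) (simp add: tree_val_range)
  also have "gval s (tau q l) a = rval s (tau q l) a x'"
    using rel by (simp add: rval_def)
  also have "ennreal \<dots> \<le> ennreal (best s (tau q l) x')"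
    by (intro ennreal_leI rval_le_best x' aAbs)
  finally show ?thesis by (simp only: l_def)
qed

text \<open>The tree recursion is bounded through the product coupling \<open>\<Otimes>\<^sub>i W i\<close>: the
  loss \<open>\<delta>\<^sup>i\<close> pays for the mass outside \<open>R i\<close>, and on the relation distinct letters are
  disjoint events, so the edges sum up without a union bound.\<close>

lemma gval_le_expected_best:
  assumes t: "t < T" and s: "s = T - 1 - t" and q: "q \<in> Q" "q \<noteq> qf"
    and x: "x \<in> space GX" and a: "a \<in> Abs" and rel: "related a x"
  shows "ennreal (gval (Suc s) q a) \<le> (\<integral>\<^sup>+u. \<integral>\<^sup>+x'. ennreal (best s (tau q (lab x')) x')
    \<partial>glob_kernel N Tk x u \<partial>PiM {..<N} (\<lambda>i. Ui i (pol t i (a i) q) (a i) (x i)))"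
proof -
  define uh where "uh i = pol t i (a i) q" for i
  define Wi where "Wi i = W i (uh i) (a i) (x i)" for i
  define \<mu> where "\<mu> i = Ui i (uh i) (a i) (x i)" for i
  define F where "F x' = ennreal (best s (tau q (lab x')) x')" for x'
  let ?E = "{(sg, z). sg \<subseteq> AP \<and> z \<in> V s \<and> tau q sg = vlabel qf z}"
  let ?g = "\<lambda>sg z i b. ind_alpha (APi i) (L i) (hh i) sg b * tval s z i b"
  have ai: "a i \<in> Xh i" and xi: "x i \<in> space (Mx i)" and uhi: "uh i \<in> Uh i" and Ri: "(a i, x i) \<in> R i"
    if "i < N" for i
    using that PiE_mem[OF a, of i] x rel pol_in[OF t that _ q(1), of "a i"]
    by (simp_all add: space_GX_iff related_def uh_def)
  have Wp: "Wi i \<in> space (prob_algebra (count_space (Xh i) \<Otimes>\<^sub>M Mx i))" if "i < N" for i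
    unfolding Wi_def using measurable_space[OF W_kernel[OF that uhi[OF that] ai[OF that]] xi[OF that]] .
  have sW: "sets (Wi i) = sets (count_space (Xh i) \<Otimes>\<^sub>M Mx i)" and pW: "prob_space (Wi i)" if "i < N" for i
    using Wp[OF that] by (auto simp: space_prob_algebra)
  have spW: "space (Wi i) = Xh i \<times> space (Mx i)" if "i < N" for i
    using sets_eq_imp_space_eq[OF sW[OF that]] by (simp add: space_pair_measure)
  have \<mu>p: "\<mu> i \<in> space (prob_algebra (Mu i))" if "i < N" for i
    unfolding \<mu>_def using measurable_space[OF Ui_kernel[OF that uhi[OF that] ai[OF that]] xi[OF that]] .
  have Tki: "Tk i (x i) \<in> Mu i \<rightarrow>\<^sub>M prob_algebra (Mx i)" if "i < N" for i
    using measurable_compose[OF measurable_Pair1'[OF xi[OF that]] Tk_kernel[OF that]] by simp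
  have snd_m: "snd \<in> Wi i \<rightarrow>\<^sub>M Mx i" if "i < N" for i
    unfolding measurable_cong_sets[OF sW[OF that] refl] by simp
  have gm: "(\<lambda>w. ennreal (?g sg z i (fst w)) * indicator (R i) w) \<in> borel_measurable (Wi i)"
    if i: "i < N" for i sg z
  proof -
    have "fst \<in> Wi i \<rightarrow>\<^sub>M count_space (Xh i)" unfolding measurable_cong_sets[OF sW[OF i] refl] by simp
    then have "(\<lambda>w. ennreal (?g sg z i (fst w))) \<in> borel_measurable (Wi i)"
      by (rule measurable_compose) simp
    moreover have "R i \<in> sets (Wi i)" using R_meas[OF i] sW[OF i] by simp
    ultimately show ?thesis by simp
  qed
  \<comment> \<open>The second marginal of the coupling already averages over the randomised
    interface input.\<close>
  have marg: "distr (Wi i) (Mx i) snd = \<mu> i \<bind> Tk i (x i)" if i: "i < N" for i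
  proof (rule measure_eqI)
    have sb: "sets (\<mu> i \<bind> Tk i (x i)) = sets (Mx i)" by (rule sets_bind'[OF \<mu>p[OF i] Tki[OF i]])
    then show "sets (distr (Wi i) (Mx i) snd) = sets (\<mu> i \<bind> Tk i (x i))" by simp
    fix B assume "B \<in> sets (distr (Wi i) (Mx i) snd)"
    then have B: "B \<in> sets (Mx i)" by simp
    interpret Wi: prob_space "Wi i" by (rule pW[OF i])
    interpret b: prob_space "\<mu> i \<bind> Tk i (x i)" by (rule prob_space_bind'[OF \<mu>p[OF i] Tki[OF i]])
    have "snd -` B \<inter> space (Wi i) = Xh i \<times> B"
      using sets.sets_into_space[OF B] by (auto simp: spW[OF i])
    then have "emeasure (distr (Wi i) (Mx i) snd) B = emeasure (Wi i) (Xh i \<times> B)"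
      using B snd_m[OF i] by (simp add: emeasure_distr)
    also have "\<dots> = emeasure (\<mu> i \<bind> Tk i (x i)) B"
      unfolding Wi.emeasure_eq_measure b.emeasure_eq_measure
      unfolding Wi_def \<mu>_def W_marg2[OF i uhi[OF i] Ri[OF i] B] ..
    finally show "emeasure (distr (Wi i) (Mx i) snd) B = emeasure (\<mu> i \<bind> Tk i (x i)) B" .
  qed
  have Fm: "F \<in> borel_measurable GX"
  proof -
    have "(\<lambda>x'. best s (tau q (lab x')) x') \<in> borel_measurable GX"
    proof (rule measurable_compose_countable'[OF measurable_best])
      have "(\<lambda>l. tau q l) \<in> count_space (Pow AP) \<rightarrow>\<^sub>M count_space Q" using tau_in q by auto
      from measurable_compose[OF measurable_lab this]
      show "(\<lambda>x'. tau q (lab x')) \<in> GX \<rightarrow>\<^sub>M count_space Q" .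
    qed (simp add: Q_fin countable_finite)
    then show ?thesis unfolding F_def[abs_def] by simp
  qed
  have agent: "ennreal (robust_op (Th i) (ind_alpha (APi i) (L i) (hh i) sg) (del i)
      (\<lambda>xh. pol t i xh q) (tval s z i) (a i))
    \<le> (\<integral>\<^sup>+w. ennreal (?g sg z i (fst w)) * indicator (R i) w \<partial>Wi i)" if i: "i < N" for i sg z
    unfolding robust_op_def uh_def[symmetric]
  proof (rule robust_op_le_coupling[OF Xh_fin[OF i] Th_in[OF i ai[OF i] uhi[OF i]] Wp[OF i] R_meas[OF i]])
    show "measure (Wi i) ({b} \<times> space (Mx i)) = pmf (Th i (a i) (uh i)) b" if "b \<in> Xh i" for b
      unfolding Wi_def using W_marg1[OF i uhi[OF i] Ri[OF i], of "{b}"] that by (simp add: measure_pmf_single)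
    show "1 - del i \<le> measure (Wi i) (R i)"
      unfolding Wi_def by (rule W_R[OF i uhi[OF i] Ri[OF i]])
    show "0 \<le> ?g sg z i b" "?g sg z i b \<le> 1" for b
      by (auto simp: ind_alpha_def tree_val_range)
  qed
  have "ennreal (gval (Suc s) q a) = ennreal (\<Sum>(sg, z)\<in>?E.
      \<Prod>i<N. robust_op (Th i) (ind_alpha (APi i) (L i) (hh i) sg) (del i)
        (\<lambda>xh. pol t i xh q) (tval s z i) (a i))"
    unfolding gval_Suc[OF q] using t by (simp add: s)
  also have "\<dots> = (\<Sum>(sg, z)\<in>?E. \<Prod>i<N. ennreal (robust_op (Th i) (ind_alpha (APi i) (L i) (hh i) sg) (del i)
        (\<lambda>xh. pol t i xh q) (tval s z i) (a i)))"
    unfolding split_beta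
    by (subst sum_ennreal[symmetric]) (simp_all add: prod_nonneg robust_op_range prod_ennreal)
  also have "\<dots> \<le> (\<Sum>(sg, z)\<in>?E. \<Prod>i<N. \<integral>\<^sup>+w. ennreal (?g sg z i (fst w)) * indicator (R i) w \<partial>Wi i)"
    unfolding split_beta by (intro sum_mono prod_mono_ennreal) (simp add: agent)
  \<comment> \<open>Independence of the agents turns the product of integrals into one integral
    against the product coupling, so that the sum over edges can be moved inside.\<close>
  also have "\<dots> = (\<Sum>(sg, z)\<in>?E. \<integral>\<^sup>+w. (\<Prod>i<N. ennreal (?g sg z i (fst (w i))) * indicator (R i) (w i)) \<partial>PiM {..<N} Wi)"
    unfolding split_beta
    by (intro sum.cong refl nn_integral_PiM_prod[symmetric]) (use pW gm in auto)
  also have "\<dots> = (\<integral>\<^sup>+w. (\<Sum>(sg, z)\<in>?E. \<Prod>i<N. ennreal (?g sg z i (fst (w i))) * indicator (R i) (w i)) \<partial>PiM {..<N} Wi)"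
    unfolding split_beta
  proof (rule nn_integral_sum[symmetric], rule borel_measurable_prod_ennreal)
    fix e i assume i: "i \<in> {..<N}"
    show "(\<lambda>w. ennreal (?g (fst e) (snd e) i (fst (w i))) * indicator (R i) (w i))
        \<in> borel_measurable (PiM {..<N} Wi)"
      using measurable_compose[OF measurable_component_singleton[OF i, of Wi] gm[of i "fst e" "snd e"]] i by simp
  qed
  also have "\<dots> \<le> (\<integral>\<^sup>+w. F (\<lambda>i\<in>{..<N}. snd (w i)) \<partial>PiM {..<N} Wi)"
    unfolding F_def
  proof (rule nn_integral_mono, rule sum_edges_le_best)
    fix w i assume "w \<in> space (PiM {..<N} Wi)" "i < N"
    then show "w i \<in> Xh i \<times> space (Mx i)" using spW by (auto simp: space_PiM PiE_iff)
  qed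
  also have "\<dots> = (\<integral>\<^sup>+x'. F x' \<partial>distr (PiM {..<N} Wi) (PiM {..<N} Mx) (\<lambda>w. \<lambda>i\<in>{..<N}. snd (w i)))"
  proof (rule nn_integral_distr[symmetric])
    show "(\<lambda>w. \<lambda>i\<in>{..<N}. snd (w i)) \<in> PiM {..<N} Wi \<rightarrow>\<^sub>M PiM {..<N} Mx"
    proof (rule measurable_restrict)
      fix i assume i: "i \<in> {..<N}"
      show "(\<lambda>w. snd (w i)) \<in> PiM {..<N} Wi \<rightarrow>\<^sub>M Mx i"
        using measurable_compose[OF measurable_component_singleton[OF i, of Wi] snd_m[of i]] i by simp
    qed
  qed (use Fm in \<open>simp add: glob_space_def\<close>)
  \<comment> \<open>Only concrete successors occur from here on, so the product coupling collapses
    to the product of its second marginals, then is split into input law and transition.\<close>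
  also have "distr (PiM {..<N} Wi) (PiM {..<N} Mx) (\<lambda>w. \<lambda>i\<in>{..<N}. snd (w i))
    = PiM {..<N} (\<lambda>i. distr (Wi i) (Mx i) snd)"
    by (rule distr_PiM_prob) (use pW snd_m in auto)
  also have "\<dots> = PiM {..<N} (\<lambda>i. \<mu> i \<bind> Tk i (x i))"
    by (rule PiM_cong) (simp_all add: marg)
  also have "\<dots> = PiM {..<N} \<mu> \<bind> (\<lambda>u. PiM {..<N} (\<lambda>i. Tk i (x i) (u i)))"
    by (rule bind_PiM[symmetric]) (use \<mu>p Tki in auto)
  also have "\<dots> = PiM {..<N} \<mu> \<bind> glob_kernel N Tk x"
    unfolding glob_kernel_def[abs_def] ..
  also have "(\<integral>\<^sup>+x'. F x' \<partial>(PiM {..<N} \<mu> \<bind> glob_kernel N Tk x))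
    = (\<integral>\<^sup>+u. \<integral>\<^sup>+x'. F x' \<partial>glob_kernel N Tk x u \<partial>PiM {..<N} \<mu>)"
  proof (rule nn_integral_bind[OF Fm])
    have "sets (PiM {..<N} \<mu>) = sets GU"
      unfolding glob_space_def by (rule sets_PiM_cong) (use \<mu>p in \<open>auto simp: space_prob_algebra\<close>)
    then have "(PiM {..<N} \<mu> \<rightarrow>\<^sub>M subprob_algebra GX) = (GU \<rightarrow>\<^sub>M subprob_algebra GX)"
      by (rule measurable_cong_sets) simp
    then show "glob_kernel N Tk x \<in> PiM {..<N} \<mu> \<rightarrow>\<^sub>M subprob_algebra GX"
      using measurable_prob_algebraD[OF measurable_compose[OF measurable_Pair1'[OF x] measurable_glob_kernel]]
      by simp
  qed
  finally show ?thesis unfolding F_def \<mu>_def uh_def .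
qed

lemma best_le_expected_best:
  assumes t: "t < T" and q: "q \<in> Q" "q \<noteq> qf" and x: "x \<in> space GX"
  shows "ennreal (best (T - t) q x) \<le> (\<integral>\<^sup>+u. \<integral>\<^sup>+x'. ennreal (best (T - Suc t) (tau q (lab x')) x')
    \<partial>glob_kernel N Tk x u \<partial>ctrl t q x)"
proof (cases "related (refine (T - t) q x) x")
  case True
  \<comment> \<open>Tree iteration number \<open>T - t\<close> applies \<open>pol t\<close>, the
    policy in force with \<open>T - t\<close> steps left.\<close>
  have eq: "Suc (T - 1 - t) = T - t" "T - Suc t = T - 1 - t" using t by auto
  have "ennreal (best (T - t) q x) = ennreal (gval (Suc (T - 1 - t)) q (refine (T - t) q x))"
    unfolding eq(1) best_def rval_def using True by simp
  also have "\<dots> \<le> (\<integral>\<^sup>+u. \<integral>\<^sup>+x'. ennreal (best (T - 1 - t) (tau q (lab x')) x')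
    \<partial>glob_kernel N Tk x u \<partial>ctrl t q x)"
    unfolding ctrl_def Let_def by (rule gval_le_expected_best[OF t refl q x refine_in[OF x] True])
  finally show ?thesis by (simp only: eq(2))
qed (simp add: best_def rval_def)

text \<open>The value 1 after acceptance is imposed explicitly: a visit to \<open>qf\<close> counts
  for good, but the DFA may leave \<open>qf\<close> again.\<close>

definition potential :: "nat \<Rightarrow> (nat \<Rightarrow> nat \<Rightarrow> 'x) \<times> (nat \<Rightarrow> nat \<Rightarrow> 'u) \<Rightarrow> ennreal" where
  "potential t hs = (if accepts_by tau q0 qf (\<lambda>k. lab (fst hs k)) t then 1
     else ennreal (best (T - t) (dstate t hs) (fst hs t)))"

lemma sets_accepts:
  "{hs \<in> space (hist_space GX GU t). accepts_by tau q0 qf (\<lambda>k. lab (fst hs k)) t} \<in> sets (hist_space GX GU t)"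
proof -
  have "{hs \<in> space (hist_space GX GU t). dstate k hs = qf} \<in> sets (hist_space GX GU t)" if "k \<le> t" for k
    using measurable_sets[OF measurable_dstate[OF that], of "{qf} \<inter> Q"] dstate_in[of k]
    by (auto simp: vimage_def Int_def conj_commute)
  then have "{hs \<in> space (hist_space GX GU t). \<exists>k\<in>{..t}. dstate k hs = qf} \<in> sets (hist_space GX GU t)"
    by (intro sets.sets_Collect_finite_Ex) auto
  moreover have "(\<exists>k\<in>{..t}. dstate k hs = qf) \<longleftrightarrow> accepts_by tau q0 qf (\<lambda>k. lab (fst hs k)) t" for hs
    unfolding accepts_by_def dstate_def by blast
  ultimately show ?thesis by (simp only:)
qed

lemma measurable_potential: "potential t \<in> borel_measurable (hist_space GX GU t)"
proof -
  have "(\<lambda>hs. best (T - t) (dstate t hs) (fst hs t)) \<in> borel_measurable (hist_space GX GU t)"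
    by (rule measurable_compose_countable'[OF _ measurable_dstate[OF order_refl]])
      (simp_all add: Q_fin countable_finite measurable_compose[OF measurable_hist_state measurable_best])
  then show ?thesis
    unfolding potential_def[abs_def] by (intro measurable_If sets_accepts) simp_all
qed

lemma potential_step:
  assumes t: "t < T" and hs: "hs \<in> space (hist_space GX GU t)"
  shows "potential t hs \<le> (\<integral>\<^sup>+u. \<integral>\<^sup>+x'. potential (Suc t) ((fst hs)(Suc t := x'), (snd hs)(t := u))
    \<partial>glob_kernel N Tk (fst hs t) u \<partial>strategy t hs)"
proof -
  define x where "x = fst hs t"
  define q where "q = dstate t hs"
  let ?ext = "\<lambda>u x'. ((fst hs)(Suc t := x'), (snd hs)(t := u))"
  have x: "x \<in> space GX" unfolding x_def by (rule measurable_space[OF measurable_hist_state hs]) simp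
  have q: "q \<in> Q" unfolding q_def by (rule dstate_in)
  have strat: "strategy t hs = ctrl t q x"
    using t by (simp add: strategy_def q_def x_def min_absorb1)
  have cp: "ctrl t q x \<in> space (prob_algebra GU)" by (rule measurable_space[OF measurable_ctrl[OF t q] x])
  have acc: "accepts_by tau q0 qf (\<lambda>k. lab (fst (?ext u x') k)) t
    \<longleftrightarrow> accepts_by tau q0 qf (\<lambda>k. lab (fst hs k)) t" for u x'
    by (rule accepts_by_cong) simp
  have dst: "dstate (Suc t) (?ext u x') = tau q (lab x')" for u x'
    unfolding q_def dstate_def dfa_run.simps
    by (subst dfa_run_cong[of t _ "\<lambda>k. lab (fst hs k)"]) auto
  show ?thesis
  proof (cases "accepts_by tau q0 qf (\<lambda>k. lab (fst hs k)) t")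
    case True
    have one: "potential (Suc t) (?ext u x') = 1" for u x'
      unfolding potential_def accepts_by_Suc acc using True by simp
    have "(\<integral>\<^sup>+u. \<integral>\<^sup>+x'. potential (Suc t) (?ext u x') \<partial>glob_kernel N Tk x u \<partial>ctrl t q x)
      = (\<integral>\<^sup>+u. 1 \<partial>ctrl t q x)"
      unfolding one
    proof (rule nn_integral_cong)
      fix u assume "u \<in> space (ctrl t q x)"
      then have "(x, u) \<in> space (GX \<Otimes>\<^sub>M GU)"
        using cp x by (auto simp: space_prob_algebra space_pair_measure dest: sets_eq_imp_space_eq)
      from measurable_space[OF measurable_glob_kernel this]
      show "(\<integral>\<^sup>+x'. 1 \<partial>glob_kernel N Tk x u) = 1"
        by (simp add: space_prob_algebra prob_space.emeasure_space_1)
    qed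
    also have "\<dots> = 1"
      using cp by (simp add: space_prob_algebra prob_space.emeasure_space_1)
    finally show ?thesis using True by (simp add: strat x_def[symmetric] potential_def)
  next
    case False
    \<comment> \<open>Without acceptance by time \<open>t\<close>, the current DFA state in
      particular differs from \<open>qf\<close>, so the tree recursion applies.\<close>
    then have qnf: "q \<noteq> qf" by (auto simp: accepts_by_def q_def dstate_def)
    have "potential t hs = ennreal (best (T - t) q x)"
      using False by (simp add: potential_def q_def x_def)
    also have "\<dots> \<le> (\<integral>\<^sup>+u. \<integral>\<^sup>+x'. ennreal (best (T - Suc t) (tau q (lab x')) x')
      \<partial>glob_kernel N Tk x u \<partial>ctrl t q x)"
      by (rule best_le_expected_best[OF t q qnf x])
    also have "\<dots> \<le> (\<integral>\<^sup>+u. \<integral>\<^sup>+x'. potential (Suc t) (?ext u x') \<partial>glob_kernel N Tk x u \<partial>ctrl t q x)"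
    proof (intro nn_integral_mono)
      fix u x'
      show "ennreal (best (T - Suc t) (tau q (lab x')) x') \<le> potential (Suc t) (?ext u x')"
      proof (cases "accepts_by tau q0 qf (\<lambda>k. lab (fst (?ext u x') k)) (Suc t)")
        case True
        \<comment> \<open>Acceptance happens exactly at this step, hence the new DFA state is
          \<open>qf\<close>, where \<open>best\<close> is at most 1.\<close>
        with False acc[of x' u] have "tau q (lab x') = qf"
          unfolding accepts_by_Suc dst[of x' u, unfolded dstate_def] by blast
        then show ?thesis
          using True best_qf_le by (simp add: potential_def ennreal_leI[of _ 1, simplified])
      next
        case nacc: False
        then have "potential (Suc t) (?ext u x')
          = ennreal (best (T - Suc t) (dstate (Suc t) (?ext u x')) (fst (?ext u x') (Suc t)))"
          by (simp only: potential_def if_False)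
        then show ?thesis unfolding dst by simp
      qed
    qed
    finally show ?thesis by (simp only: strat x_def)
  qed
qed

lemma tree_value_le_acceptance:
  assumes R_init: "\<And>i. i < N \<Longrightarrow> (xh0 i, x0 i) \<in> R i"
  shows "gval T (tau q0 (glob_label N L hh xh0)) xh0
    \<le> measure (closed_loop GX GU (glob_kernel N Tk) (restrict x0 {..<N}) strategy T)
         {hs \<in> space (hist_space GX GU T). accepts_by tau q0 qf (\<lambda>k. lab (fst hs k)) T}"
    (is "_ \<le> measure ?CL ?A")
proof -
  let ?x = "restrict x0 {..<N}" and ?a = "restrict xh0 {..<N}"
  let ?q = "tau q0 (glob_label N L hh xh0)"
  have rel: "related ?a ?x" using R_init by (simp add: related_def)
  have a: "?a \<in> Abs" by (rule related_in_Abs[OF rel]) simp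
  have x: "?x \<in> space GX"
    using sets.sets_into_space[OF R_meas] R_init by (fastforce simp: space_GX_iff space_pair_measure)
  interpret controlled_kernel GX GU "glob_kernel N Tk" ?x strategy
    by unfold_locales (fact measurable_glob_kernel x is_strategy_strategy)+
  interpret CL: prob_space ?CL using closed_loop_prob[of T] by (simp add: space_prob_algebra)
  have sCL: "sets ?CL = sets (H T)" using closed_loop_prob[of T] by (simp add: space_prob_algebra)
  have q: "?q = tau q0 (lab ?x)"
    using related_label[OF rel] by (simp add: glob_label_def)
  have "ennreal (gval T ?q xh0) \<le> potential 0 (\<lambda>j\<in>{..0}. ?x, \<lambda>_. undefined)"
  \<comment> \<open>The initial label alone may already be accepting; then both sides are 1.\<close>
  proof (cases "?q = qf")
    case True
    then show ?thesis using q by (simp add: potential_def gval_qf)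
  next
    case False
    have "gval T ?q xh0 = rval T ?q ?a ?x"
      using rel gval_cong[of xh0 ?a] by (simp add: rval_def)
    also have "\<dots> \<le> best T ?q ?x" by (rule rval_le_best[OF x a])
    finally show ?thesis using False q by (simp add: potential_def dstate_def ennreal_leI)
  qed
  also have "\<dots> \<le> (\<integral>\<^sup>+hs. potential T hs \<partial>?CL)"
    by (rule closed_loop_submartingale[OF measurable_potential potential_step])
  also have "\<dots> \<le> (\<integral>\<^sup>+hs. indicator ?A hs \<partial>?CL)"
  proof (rule nn_integral_mono)
    fix hs assume "hs \<in> space ?CL"
    then have hs: "hs \<in> space (H T)" using sets_eq_imp_space_eq[OF sCL] by simp
    show "potential T hs \<le> indicator ?A hs"
    proof (cases "accepts_by tau q0 qf (\<lambda>k. lab (fst hs k)) T")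
      case True
      then show ?thesis using hs by (simp add: potential_def)
    next
      case False
      \<comment> \<open>With no steps left and a state other than \<open>qf\<close>, the value is 0,
        so the terminal potential is at most the indicator.\<close>
      then have "dstate T hs \<noteq> qf" by (auto simp: accepts_by_def dstate_def)
      then show ?thesis using False by (simp add: potential_def best_0)
    qed
  qed
  also have "\<dots> = emeasure ?CL ?A"
    using sets_accepts sCL by (intro nn_integral_indicator) simp
  finally show ?thesis
    by (simp add: CL.emeasure_eq_measure)
qed

end

theorem theorem2:
  fixes N :: nat
    and Xh :: "nat \<Rightarrow> 'xh set" and Uh :: "nat \<Rightarrow> 'uh set"
    and Th :: "nat \<Rightarrow> 'xh \<Rightarrow> 'uh \<Rightarrow> 'xh pmf" and xh0 :: "nat \<Rightarrow> 'xh"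
    and hh :: "nat \<Rightarrow> 'xh \<Rightarrow> 'y::metric_space"
    and X :: "nat \<Rightarrow> 'x::polish_space set" and U :: "nat \<Rightarrow> 'u::polish_space set"
    and Tk :: "nat \<Rightarrow> 'x \<Rightarrow> 'u \<Rightarrow> 'x measure" and x0 :: "nat \<Rightarrow> 'x"
    and h :: "nat \<Rightarrow> 'x \<Rightarrow> 'y"
    and APi :: "nat \<Rightarrow> 'ap set" and L :: "nat \<Rightarrow> 'y \<Rightarrow> 'ap set"
    and Q :: "'q set" and q0 :: 'q and tau :: "'q \<Rightarrow> 'ap set \<Rightarrow> 'q" and qf :: 'q
    and del :: "nat \<Rightarrow> real"
    and R :: "nat \<Rightarrow> ('xh \<times> 'x) set"
    and Ui :: "nat \<Rightarrow> 'uh \<Rightarrow> 'xh \<Rightarrow> 'x \<Rightarrow> 'u measure"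
    and W :: "nat \<Rightarrow> 'uh \<Rightarrow> 'xh \<Rightarrow> 'x \<Rightarrow> ('xh \<times> 'x) measure"
    and T :: nat
    and pol :: "nat \<Rightarrow> nat \<Rightarrow> 'xh \<Rightarrow> 'q \<Rightarrow> 'uh"
  defines "Mx \<equiv> \<lambda>i. restrict_space borel (X i)"
    and "Mu \<equiv> \<lambda>i. restrict_space borel (U i)"
    and "AP \<equiv> (\<Union>i<N. APi i)"
  assumes N_pos: "0 < N"
    \<comment> \<open>concrete agents M^i: Polish state/input spaces, stochastic kernel, initial state, measurable output\<close>
    and X_polish: "\<forall>i<N. completely_metrizable_space (top_of_set (X i))"
    and U_polish: "\<forall>i<N. completely_metrizable_space (top_of_set (U i))"
    and Tk_kernel: "\<forall>i<N. (\<lambda>(x, u). Tk i x u) \<in> (Mx i \<Otimes>\<^sub>M Mu i) \<rightarrow>\<^sub>M prob_algebra (Mx i)"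
    and x0_in: "\<forall>i<N. x0 i \<in> X i"
    and h_meas: "\<forall>i<N. h i \<in> Mx i \<rightarrow>\<^sub>M borel"
    \<comment> \<open>finite abstract agents Mhat^i\<close>
    and Xh_fin: "\<forall>i<N. finite (Xh i)" and Uh_fin: "\<forall>i<N. finite (Uh i)"
    and xh0_in: "\<forall>i<N. xh0 i \<in> Xh i"
    and Th_in: "\<forall>i<N. \<forall>xh\<in>Xh i. \<forall>uh\<in>Uh i. set_pmf (Th i xh uh) \<subseteq> Xh i"
    \<comment> \<open>specification: disjoint AP_i, labellings, DFA\<close>
    and APi_fin: "\<forall>i<N. finite (APi i)"
    and APi_disj: "\<forall>i<N. \<forall>j<N. i \<noteq> j \<longrightarrow> APi i \<inter> APi j = {}"
    and L_range: "\<forall>i<N. \<forall>y. L i y \<subseteq> APi i"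
    and L_meas: "\<forall>i<N. L i \<in> borel \<rightarrow>\<^sub>M count_space UNIV"
    and Q_fin: "finite Q" and q0_in: "q0 \<in> Q" and qf_in: "qf \<in> Q"
    and tau_in: "\<forall>q\<in>Q. \<forall>sg. sg \<subseteq> AP \<longrightarrow> tau q sg \<in> Q"
    \<comment> \<open>Mhat^i is (0, delta^i)-simulated by M^i\<close>
    and del_range: "\<forall>i<N. 0 \<le> del i \<and> del i \<le> 1"
    and R_sub: "\<forall>i<N. R i \<subseteq> Xh i \<times> X i"
    and R_meas: "\<forall>i<N. R i \<in> sets (count_space (Xh i) \<Otimes>\<^sub>M Mx i)"
    and R_init: "\<forall>i<N. (xh0 i, x0 i) \<in> R i"
    and R_out: "\<forall>i<N. \<forall>(xh, x)\<in>R i. dist (hh i xh) (h i x) \<le> 0"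
    and Ui_kernel: "\<forall>i<N. \<forall>uh\<in>Uh i. \<forall>xh\<in>Xh i.
                      (\<lambda>x. Ui i uh xh x) \<in> Mx i \<rightarrow>\<^sub>M prob_algebra (Mu i)"
    and W_kernel: "\<forall>i<N. \<forall>uh\<in>Uh i. \<forall>xh\<in>Xh i.
                      (\<lambda>x. W i uh xh x) \<in> Mx i \<rightarrow>\<^sub>M prob_algebra (count_space (Xh i) \<Otimes>\<^sub>M Mx i)"
    and W_marg1: "\<forall>i<N. \<forall>uh\<in>Uh i. \<forall>(xh, x)\<in>R i. \<forall>A. A \<subseteq> Xh i \<longrightarrow>
                      measure (W i uh xh x) (A \<times> X i) = measure_pmf.prob (Th i xh uh) A"
    and W_marg2: "\<forall>i<N. \<forall>uh\<in>Uh i. \<forall>(xh, x)\<in>R i. \<forall>B\<in>sets (Mx i).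
                      measure (W i uh xh x) (Xh i \<times> B) = measure (Ui i uh xh x \<bind> Tk i x) B"
    and W_R: "\<forall>i<N. \<forall>uh\<in>Uh i. \<forall>(xh, x)\<in>R i. 1 - del i \<le> measure (W i uh xh x) (R i)"
    \<comment> \<open>horizon and Markov policy pi[0..T-1]\<close>
    and T_pos: "1 \<le> T"
    and pol_in: "\<forall>t<T. \<forall>i<N. \<forall>xh\<in>Xh i. \<forall>q\<in>Q. pol t i xh q \<in> Uh i"
  shows "\<exists>C. is_strategy (glob_space N Mx) (glob_space N Mu) C \<and>
    (\<Sum>z\<in>{z \<in> tree_vertices AP Q tau qf T. vlabel qf z = tau q0 (glob_label N L hh xh0)}.
        \<Prod>i<N. tree_val Th APi L hh del pol T T z i (xh0 i))
    \<le> measure (closed_loop (glob_space N Mx) (glob_space N Mu) (glob_kernel N Tk)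
                  (restrict x0 {..<N}) C T)
         {hs \<in> space (hist_space (glob_space N Mx) (glob_space N Mu) T).
            accepts_by tau q0 qf (\<lambda>k. glob_label N L h (fst hs k)) T}"
proof -
  interpret simulated_agents N Xh Uh Th hh Mx Mu Tk h APi L Q q0 tau qf del R Ui W T pol AP
  proof unfold_locales
    fix i assume i: "i < N"
    have X: "space (Mx i) = X i" by (simp add: Mx_def space_restrict_space)
    show "(\<lambda>(x, u). Tk i x u) \<in> Mx i \<Otimes>\<^sub>M Mu i \<rightarrow>\<^sub>M prob_algebra (Mx i)"
      using Tk_kernel i by blast
    show "finite (Xh i)" "Xh i \<noteq> {}" "finite (APi i)"
      using Xh_fin xh0_in APi_fin i by auto
    show "L i y \<subseteq> APi i" for y using L_range i by blast
    show "(\<lambda>x. L i (h i x)) \<in> Mx i \<rightarrow>\<^sub>M count_space UNIV"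
      using h_meas L_meas i by (blast intro: measurable_compose)
    show "APi i \<inter> APi j = {}" if "j < N" "i \<noteq> j" for j
      using APi_disj i that by blast
    show "R i \<in> sets (count_space (Xh i) \<Otimes>\<^sub>M Mx i)" using R_meas i by blast
    show "hh i xh = h i x" if "(xh, x) \<in> R i" for xh x
      using R_out i that by fastforce
    show "set_pmf (Th i xh uh) \<subseteq> Xh i" if "xh \<in> Xh i" "uh \<in> Uh i" for xh uh
      using Th_in i that by blast
    show "Ui i uh xh \<in> Mx i \<rightarrow>\<^sub>M prob_algebra (Mu i)" if "uh \<in> Uh i" "xh \<in> Xh i" for uh xh
      using Ui_kernel i that by simp
    show "W i uh xh \<in> Mx i \<rightarrow>\<^sub>M prob_algebra (count_space (Xh i) \<Otimes>\<^sub>M Mx i)"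
      if "uh \<in> Uh i" "xh \<in> Xh i" for uh xh
      using W_kernel i that by simp
    show "measure (W i uh xh x) (A \<times> space (Mx i)) = measure_pmf.prob (Th i xh uh) A"
      if "uh \<in> Uh i" "(xh, x) \<in> R i" "A \<subseteq> Xh i" for uh xh x A
      unfolding X using W_marg1 i that by blast
    show "measure (W i uh xh x) (Xh i \<times> B) = measure (Ui i uh xh x \<bind> Tk i x) B"
      if "uh \<in> Uh i" "(xh, x) \<in> R i" "B \<in> sets (Mx i)" for uh xh x B
      using W_marg2 i that by blast
    show "1 - del i \<le> measure (W i uh xh x) (R i)"
      if "uh \<in> Uh i" "(xh, x) \<in> R i" for uh xh x
      using W_R i that by blast
    show "pol t i xh q \<in> Uh i" if "t < T" "xh \<in> Xh i" "q \<in> Q" for t xh q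
      using pol_in i that by blast
  next
    show "tau q sg \<in> Q" if "q \<in> Q" "sg \<subseteq> (\<Union>i<N. APi i)" for q sg
      using tau_in that unfolding AP_def by blast
  qed (fact AP_def Q_fin q0_in T_pos)+
  show ?thesis
  proof (intro exI conjI)
    show "is_strategy (glob_space N Mx) (glob_space N Mu) strategy"
      by (rule is_strategy_strategy)
    show "(\<Sum>z\<in>{z \<in> tree_vertices AP Q tau qf T. vlabel qf z = tau q0 (glob_label N L hh xh0)}.
        \<Prod>i<N. tree_val Th APi L hh del pol T T z i (xh0 i))
      \<le> measure (closed_loop (glob_space N Mx) (glob_space N Mu) (glob_kernel N Tk)
                  (restrict x0 {..<N}) strategy T)
         {hs \<in> space (hist_space (glob_space N Mx) (glob_space N Mu) T).
            accepts_by tau q0 qf (\<lambda>k. glob_label N L h (fst hs k)) T}"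
      using tree_value_le_acceptance[of xh0 x0] R_init unfolding gval_def by blast
  qed
qed

end
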